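(* Let $f\in\mathbb{Z}[x_1^{\pm1},\dots,x_{n-1}^{\pm1}]$ be a Laurent polynomial with integer coefficients satisfying the following condition (H): there exists an index $i$ such that, when $f$ is written as a Laurent polynomial in $x_i$ with coefficients in the ring of Laurent polynomials in the other variables, the coefficient of the term of highest degree in $x_i$ is a monomial in the other variables. Then there exists a constant $C_1$ depending only on $f$ such that for almost all primes $q$ (hence, after enlarging $C_1$, for every prime $q$), $$|K(f,q)|\le C_1\,q^{(n-1)-\frac12}.$$
   Context: For a positive integer $q$, $$K(f,q)=\sum_{p_1,\dots,p_{n-1}}\exp\!\left(\frac{2\pi i}{q}f(p_1,\dots,p_{n-1})\right),$$ where $i=\sqrt{-1}$ in the exponential, the sum is over $(p_1,\dots,p_{n-1})\in\mathbb{Z}^{n-1}$ with $1\le p_j<q$ and $p_j$ relatively prime to $q$ for all $j$, and $p_j^{-1}$ means an integer inverse to $p_j$ modulo $q$. A monomial means a nonzero integer constant times a product of (possibly negative or zero) powers of the variables.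
   Formalization: The Laurent polynomial f is additionally assumed not to be a constant: a nonzero constant f satisfies condition (H) literally, but then |K(f,q)| = (q-1)^(n-1) for every prime q, so the claimed bound fails. *)

theory Defs
  imports Complex_Main "HOL-Library.Poly_Mapping" "HOL-Number_Theory.Modular_Inverse"
begin

text \<open>
  A Laurent polynomial over the integers is an element of the group ring of its exponent
  vectors: an exponent vector \<open>e\<close> stands for the product of the \<open>x\<^sub>j ^ e\<^sub>j\<close>, and the
  convolution product on \<open>\<Rightarrow>\<^sub>0\<close> is the product of Laurent polynomials.
\<close>

type_synonym exponent = "nat \<Rightarrow>\<^sub>0 int"
type_synonym laurent_poly = "exponent \<Rightarrow>\<^sub>0 int"

text \<open>The ring of Laurent polynomials in \<open>x\<^sub>1, \<dots>, x\<^sub>n\<^sub>-\<^sub>1\<close>.\<close>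

definition laurent_polys :: "nat \<Rightarrow> laurent_poly set" where
  "laurent_polys n = {f. \<forall>e \<in> Poly_Mapping.keys f. Poly_Mapping.keys e \<subseteq> {1..<n}}"

definition is_monomial :: "laurent_poly \<Rightarrow> bool" where
  "is_monomial g \<longleftrightarrow> (\<exists>c e. c \<noteq> 0 \<and> g = Poly_Mapping.single e c)"

text \<open>
  The coefficient of \<open>x\<^sub>i ^ d\<close> in \<open>f\<close>, as a Laurent polynomial in the other variables.
  See \<open>expansion_in\<close> and \<open>coeff_in_not_involving\<close> below.
\<close>

definition coeff_in :: "nat \<Rightarrow> int \<Rightarrow> laurent_poly \<Rightarrow> laurent_poly" where
  "coeff_in i d f =
     (\<Sum>e | e \<in> Poly_Mapping.keys f \<and> Poly_Mapping.lookup e i = d.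
        Poly_Mapping.single (Poly_Mapping.update i 0 e) (Poly_Mapping.lookup f e))"

definition degrees_in :: "nat \<Rightarrow> laurent_poly \<Rightarrow> int set" where
  "degrees_in i f = {d. coeff_in i d f \<noteq> 0}"

definition lead_coeff_in :: "nat \<Rightarrow> laurent_poly \<Rightarrow> laurent_poly" where
  "lead_coeff_in i f = coeff_in i (Max (degrees_in i f)) f"

text \<open>
  For \<open>f = 0\<close> the set of degrees is empty and its \<open>Max\<close> is unspecified, but every
  coefficient is then \<open>0\<close>, which is not a monomial, so the condition fails.
\<close>

definition condition_H :: "nat \<Rightarrow> laurent_poly \<Rightarrow> bool" where
  "condition_H n f \<longleftrightarrow> (\<exists>i \<in> {1..<n}. is_monomial (lead_coeff_in i f))"

text \<open>\<open>p ^ k\<close> modulo \<open>q\<close>, with \<open>p ^ -1\<close> an integer inverse of \<open>p\<close> modulo \<open>q\<close>.\<close>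

definition power_mod_inv :: "nat \<Rightarrow> int \<Rightarrow> int \<Rightarrow> int" where
  "power_mod_inv q p k =
     (if k \<ge> 0 then p ^ nat k else modular_inverse (int q) p ^ nat (- k))"

definition eval_mod :: "nat \<Rightarrow> laurent_poly \<Rightarrow> (nat \<Rightarrow> int) \<Rightarrow> int" where
  "eval_mod q f p =
     (\<Sum>e \<in> Poly_Mapping.keys f. Poly_Mapping.lookup f e *
        (\<Prod>j \<in> Poly_Mapping.keys e. power_mod_inv q (p j) (Poly_Mapping.lookup e j)))"

definition K :: "nat \<Rightarrow> laurent_poly \<Rightarrow> nat \<Rightarrow> complex" where
  "K n f q =
     (\<Sum>p \<in> {1..<n} \<rightarrow>\<^sub>E {a::int. 1 \<le> a \<and> a < int q \<and> coprime a (int q)}.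
        exp (2 * of_real pi * \<i> / of_nat q * of_int (eval_mod q f p)))"

lemma coeff_in_not_involving:
  assumes "e \<in> Poly_Mapping.keys (coeff_in i d f)"
  shows "i \<notin> Poly_Mapping.keys e"
proof -
  have "Poly_Mapping.keys (coeff_in i d f) \<subseteq>
      (\<Union>e \<in> {e \<in> Poly_Mapping.keys f. Poly_Mapping.lookup e i = d}.
        Poly_Mapping.keys (Poly_Mapping.single (Poly_Mapping.update i 0 e)
          (Poly_Mapping.lookup f e)))"
    unfolding coeff_in_def by (rule keys_sum)
  with assms obtain e' where "e = Poly_Mapping.update i 0 e'"
    by (auto split: if_splits)
  then show ?thesis by (simp add: keys_update)
qed

lemma coeff_in_outside:
  assumes "d \<notin> (\<lambda>e. Poly_Mapping.lookup e i) ` Poly_Mapping.keys f"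
  shows "coeff_in i d f = 0"
proof -
  have "{e \<in> Poly_Mapping.keys f. Poly_Mapping.lookup e i = d} = {}"
    using assms by auto
  then show ?thesis by (simp only: coeff_in_def sum.empty)
qed

lemma degrees_in_subset:
  "degrees_in i f \<subseteq> (\<lambda>e. Poly_Mapping.lookup e i) ` Poly_Mapping.keys f"
proof
  fix d assume "d \<in> degrees_in i f"
  then have "coeff_in i d f \<noteq> 0" by (simp add: degrees_in_def)
  then show "d \<in> (\<lambda>e. Poly_Mapping.lookup e i) ` Poly_Mapping.keys f"
    using coeff_in_outside[of d i f] by blast
qed

lemma finite_degrees_in: "finite (degrees_in i f)"
  by (rule finite_subset[OF degrees_in_subset]) simp

lemma expansion_in:
  "f = (\<Sum>d \<in> degrees_in i f.
          Poly_Mapping.single (Poly_Mapping.single i d) 1 * coeff_in i d f)"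
proof -
  let ?S = "\<lambda>e. Poly_Mapping.single e (Poly_Mapping.lookup f e)"
  let ?D = "(\<lambda>e. Poly_Mapping.lookup e i) ` Poly_Mapping.keys f"
  have split: "Poly_Mapping.single i (Poly_Mapping.lookup e i) + Poly_Mapping.update i 0 e = e"
    for e :: exponent
    by (rule poly_mapping_eqI) (auto simp: lookup_add lookup_update lookup_single when_def)
  have term_d: "Poly_Mapping.single (Poly_Mapping.single i d) 1 * coeff_in i d f =
      (\<Sum>e | e \<in> Poly_Mapping.keys f \<and> Poly_Mapping.lookup e i = d. ?S e)" for d
    unfolding coeff_in_def sum_distrib_left
    by (rule sum.cong) (auto simp: mult_single split)
  have "f = (\<Sum>e \<in> Poly_Mapping.keys f. ?S e)"
    by (rule poly_mapping_eqI)
       (auto simp: lookup_sum lookup_single when_def in_keys_iff)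
  also have "\<dots> = (\<Sum>d \<in> ?D. \<Sum>e | e \<in> Poly_Mapping.keys f \<and> Poly_Mapping.lookup e i = d. ?S e)"
    by (rule sum.image_gen) simp
  also have "\<dots> = (\<Sum>d \<in> ?D. Poly_Mapping.single (Poly_Mapping.single i d) 1 * coeff_in i d f)"
    by (simp only: term_d)
  also have "\<dots> = (\<Sum>d \<in> degrees_in i f.
      Poly_Mapping.single (Poly_Mapping.single i d) 1 * coeff_in i d f)"
    using degrees_in_subset by (intro sum.mono_neutral_right) (auto simp: degrees_in_def)
  finally show ?thesis .
qed

end

(*
For almost every choice of the other variables, f is modulo q a nonconstant Laurent polynomial in a
variable x_i that occurs in it, and Weil's bound O(sqrt q) applies to the sum over x_i; the exceptional
choices are the zeros of a nonzero Laurent polynomial in n - 2 variables, a fraction O(1/q) of all.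

Weil's bound is obtained by Stepanov's method in Bombieri's form. Over the field with p^r elements the
points x with f(x) of trace t lift to an Artin-Schreier curve y^p = y + f(x) - b; a function on it of small
pole order that vanishes at all rational points is built by a pigeonhole argument, whence
S_r = O(p^(r/2)) for large r. The S_r are the coefficients of T L'(T)/L(T) for a polynomial L of degree
at most 2D, where D bounds the exponents of f in absolute value. So the zeros of L have absolute value at
least p^(-1/2), and S_1, minus the sum of their inverses, is at most 2D sqrt p.
*)
theory Submission
  imports Defs "HOL-Analysis.FPS_Convergence" "HOL-Algebra.Algebraic_Closure_Type"
    "Berlekamp_Zassenhaus.Finite_Field"
begin

hide_const (open) Polynomials.degree up_ring.coeff up_ring.monom Coset.order
  Polynomials.lead_coeff module.smult Divisibility.prime Divisibility.irreducible

section \<open>Finite fields and additive characters\<close>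

text \<open>Stepanov's bound holds only for large r and with a constant that grows with p, so it
  says nothing about S_1 by itself. The L-function repairs this: only the growth rate of S_r in r
  limits where the zeros of L can lie, so these constants drop out, and the factor that remains is
  the number of zeros, which is bounded through the exponents of f alone. This uniformity in p is
  what lets one constant serve all primes. The exponents must be smaller than p. Then a leading
  exponent n > 0 is prime to p, which separates the pole orders on the curve, and n is invertible
  modulo p, which makes the high coefficients of L vanish. The finitely many primes that are too
  small for f are left to the trivial bound. Negative exponents give f a second pole, at 0.
  Multiplying by a power of x whose exponent is divisible by p removes it and keeps the shape of the
  Artin-Schreier equation, so only pole orders at infinity have to be controlled.\<close>

definition frob :: "nat \<Rightarrow> 'a::field_prime_char \<Rightarrow> 'a" where
  "frob i x = x ^ (CHAR('a) ^ i)"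

text \<open>For \<open>r > 0\<close> and \<open>'a\<close> algebraically closed this is the field
  with \<open>CHAR('a) ^ r\<close> elements. As fixed sets of Frobenius powers, all finite
  extensions lie in one type. For \<open>r = 0\<close> the set is the whole type, hence the
  assumptions \<open>r > 0\<close> below.\<close>

definition subfld :: "nat \<Rightarrow> 'a::field_prime_char set" where
  "subfld r = {x. frob r x = x}"

definition trace_to_prime :: "nat \<Rightarrow> 'a::field_prime_char \<Rightarrow> 'a" where
  "trace_to_prime r x = (\<Sum>i<r. frob i x)"

lemma prime_CHAR_field: "prime CHAR('a::field_prime_char)"
  by (rule CHAR_prime)

lemma CHAR_gt_1: "CHAR('a::field_prime_char) > 1"
  using prime_CHAR_field[where ?'a = 'a] prime_gt_1_nat by blast

lemma frob_0 [simp]: "frob 0 x = x"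
  by (simp add: frob_def)

lemma frob_frob: "frob i (frob j x) = frob (i + j) x"
  by (simp add: frob_def power_add mult.commute flip: power_mult)

lemma frob_add: "frob i (x + y) = frob i x + frob i y"
  unfolding frob_def by (rule freshmans_dream') (auto simp: prime_CHAR_field)

lemma frob_sum: "frob i (sum f A) = (\<Sum>x\<in>A. frob i (f x))"
  unfolding frob_def by (rule freshmans_dream_sum') (auto simp: prime_CHAR_field)

lemma frob_mult: "frob i (x * y) = frob i x * frob i y"
  by (simp add: frob_def power_mult_distrib)

lemma frob_power: "frob i (x ^ n) = frob i x ^ n"
  by (simp add: frob_def mult.commute flip: power_mult)

lemma frob_inverse: "frob i (inverse x) = inverse (frob i x)"
  by (simp add: frob_def power_inverse)

lemma frob_powi: "frob i (x powi n) = frob i x powi n"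
  by (auto simp: power_int_def frob_power frob_inverse)

lemma frob_zero [simp]: "frob i 0 = 0"
  using CHAR_gt_1[where ?'a = 'a] by (simp add: frob_def)

lemma frob_one [simp]: "frob i 1 = 1"
  by (simp add: frob_def)

lemma frob_eq_0_iff [simp]: "frob i x = 0 \<longleftrightarrow> x = 0"
  by (simp add: frob_def)

lemma frob_uminus: "frob i (- x) = - frob i x"
  using frob_add[of i x "- x"] by (simp add: add_eq_0_iff)

lemma frob_diff: "frob i (x - y) = frob i x - frob i y"
  using frob_add[of i x "- y"] by (simp add: frob_uminus)

lemma frob_inj: "frob i x = frob i y \<longleftrightarrow> x = y"
  using frob_diff[of i x y] by auto

lemma inj_frob: "inj (frob i)"
  by (simp add: inj_def frob_inj)

lemma frob_sum_mset: "frob i (sum_mset A) = sum_mset (image_mset (frob i) A)"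
  by (induction A) (auto simp: frob_add)

lemma subfldD: "x \<in> subfld r \<Longrightarrow> frob r x = x"
  by (simp add: subfld_def)

lemma subfld_0 [simp]: "0 \<in> subfld r"
  and subfld_1 [simp]: "1 \<in> subfld r"
  by (simp_all add: subfld_def)

lemma subfld_add: "x \<in> subfld r \<Longrightarrow> y \<in> subfld r \<Longrightarrow> x + y \<in> subfld r"
  and subfld_diff: "x \<in> subfld r \<Longrightarrow> y \<in> subfld r \<Longrightarrow> x - y \<in> subfld r"
  and subfld_mult: "x \<in> subfld r \<Longrightarrow> y \<in> subfld r \<Longrightarrow> x * y \<in> subfld r"
  and subfld_uminus: "x \<in> subfld r \<Longrightarrow> - x \<in> subfld r"
  and subfld_inverse: "x \<in> subfld r \<Longrightarrow> inverse x \<in> subfld r"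
  and subfld_power: "x \<in> subfld r \<Longrightarrow> x ^ n \<in> subfld r"
  and subfld_powi: "x \<in> subfld r \<Longrightarrow> x powi k \<in> subfld r"
  by (simp_all add: subfld_def frob_add frob_diff frob_mult frob_uminus frob_inverse frob_power frob_powi)

lemma subfld_sum: "(\<And>x. x \<in> A \<Longrightarrow> f x \<in> subfld r) \<Longrightarrow> sum f A \<in> subfld r"
  by (induction A rule: infinite_finite_induct) (auto intro: subfld_add)

lemma subfld_of_nat [simp]: "of_nat n \<in> subfld r"
  by (induction n) (auto intro: subfld_add)

lemma subfld_of_int [simp]: "of_int n \<in> subfld r"
  by (cases n rule: int_cases2) (auto intro: subfld_uminus)

lemma subfld_mult_index: "x \<in> subfld r \<Longrightarrow> frob (r * k) x = x"
  by (induction k) (auto simp: subfldD simp flip: frob_frob)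

lemma subfld_1_subset: "x \<in> subfld 1 \<Longrightarrow> x \<in> subfld r"
  using subfld_mult_index[of x 1 r] by (simp add: subfld_def)

section \<open>Sizes of the finite subfields\<close>

lemma linear_factors_nonzero: "(\<Prod>x\<in>#A. [:-x, 1:]) \<noteq> (0 :: 'a::idom poly)"
  by (auto simp: prod_mset_zero_iff)

lemma proots_linear_factors: "proots (\<Prod>x\<in>#A. [:-x, 1:]) = (A :: 'a::idom multiset)"
proof (induction A)
  case (add x A)
  have "proots ([:-x, 1:] * (\<Prod>x\<in>#A. [:-x, 1:])) = {#x#} + A"
    by (subst proots_mult) (use add linear_factors_nonzero[of A] in auto)
  then show ?case by (simp del: mult_pCons_left)
qed auto

text \<open>Over an algebraically closed field the degree counts roots with multiplicity, and a root
  of order at least 2 would also be a root of the derivative.\<close>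

lemma card_poly_roots_separable:
  fixes g :: "'a::alg_closed_field poly"
  assumes "degree g > 0" "\<And>x. poly g x = 0 \<Longrightarrow> poly (pderiv g) x \<noteq> 0"
  shows "card {x. poly g x = 0} = degree g"
proof -
  have "g \<noteq> 0" using assms(1) by auto
  then obtain A where A: "size A = degree g" "g = smult (lead_coeff g) (\<Prod>x\<in>#A. [:-x, 1:])"
    using alg_closed_imp_factorization by blast
  have roots: "proots g = A"
  proof -
    have "proots g = proots (\<Prod>x\<in>#A. [:-x, 1:])"
      by (subst A(2)) (use \<open>g \<noteq> 0\<close> in auto)
    also have "\<dots> = A" by (rule proots_linear_factors)
    finally show ?thesis .
  qed
  have ord: "order x g \<le> 1" for x
  proof (rule ccontr)
    assume "\<not> order x g \<le> 1"
    then have "[:-x, 1:] ^ 2 dvd g" by (simp add: order_divides)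
    then obtain h where h: "g = [:-x, 1:] * ([:-x, 1:] * h)"
      by (metis dvdE mult.assoc power2_eq_square)
    have "poly g x = 0" "poly (pderiv g) x = 0"
      by (simp_all add: h pderiv_mult del: mult_pCons_left)
    with assms(2) show False by blast
  qed
  have "count A x = count (mset_set {x. poly g x = 0}) x" for x
    using \<open>g \<noteq> 0\<close> poly_roots_finite[of g] count_proots[of g x] ord[of x] roots
    by (auto simp: count_mset_set' le_Suc_eq order_root)
  then have "A = mset_set {x. poly g x = 0}" by (rule multiset_eqI)
  then show ?thesis using A(1) by simp
qed

text \<open>The polynomial \<open>x ^ q - x\<close> with \<open>q = CHAR('a) ^ r\<close> has
  derivative -1, so its roots are simple.\<close>

lemma card_subfld:
  assumes "r > 0"
  shows "card (subfld r :: 'a::{alg_closed_field,field_prime_char} set) = CHAR('a) ^ r"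
proof -
  define q where "q = CHAR('a) ^ r"
  have q: "q > 1"
    using assms CHAR_gt_1[where ?'a = 'a] unfolding q_def by (intro one_less_power)
  define g :: "'a poly" where "g = monom 1 q - monom 1 1"
  have deg: "degree g = q"
    unfolding g_def diff_conv_add_uminus by (subst degree_add_eq_left) (use q in \<open>auto simp: degree_monom_eq\<close>)
  have "of_nat q = (0::'a)" using assms by (simp add: q_def)
  then have "poly (pderiv g) x = -1" for x
    by (simp add: g_def pderiv_diff pderiv_monom)
  then have "card {x. poly g x = 0} = degree g"
    using q deg by (intro card_poly_roots_separable) auto
  also have "{x. poly g x = 0} = subfld r"
    by (auto simp: g_def poly_monom subfld_def frob_def q_def)
  finally show ?thesis using deg by (simp add: q_def)
qed

lemma finite_subfld: "r > 0 \<Longrightarrow> finite (subfld r :: 'a::{alg_closed_field,field_prime_char} set)"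
  using card_subfld[of r, where ?'a = 'a] CHAR_gt_1[where ?'a = 'a] by (intro card_ge_0_finite) simp

lemma inj_on_of_nat_CHAR: "inj_on (of_nat :: nat \<Rightarrow> 'a::field_prime_char) {..<CHAR('a)}"
  by (auto simp: inj_on_def of_nat_eq_iff_cong_CHAR cong_less_modulus_unique_nat)

lemma prime_subfld_eq:
  "(subfld 1 :: 'a::{alg_closed_field,field_prime_char} set) = of_nat ` {..<CHAR('a)}"
proof (rule card_subset_eq[symmetric])
  show "card (of_nat ` {..<CHAR('a)} :: 'a set) = card (subfld 1 :: 'a set)"
    by (simp add: card_subfld card_image inj_on_of_nat_CHAR)
qed (auto simp: finite_subfld)

section \<open>Trace and additive character of the prime field\<close>

lemma trace_to_prime_diff: "trace_to_prime r (x - y) = trace_to_prime r x - trace_to_prime r y"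
  by (simp add: trace_to_prime_def frob_diff sum_subtractf)

text \<open>Frobenius shifts the list of conjugates: \<open>x\<close> drops out and
  \<open>frob r x\<close>, which equals \<open>x\<close>, comes in.\<close>

lemma trace_in_prime:
  assumes "x \<in> subfld r" shows "trace_to_prime r x \<in> subfld 1"
proof -
  have "frob 1 (trace_to_prime r x) = (\<Sum>i<r. frob (Suc i) x)"
    by (simp add: trace_to_prime_def frob_sum frob_frob)
  also have "\<dots> = trace_to_prime r x + frob r x - x"
    using sum.lessThan_Suc_shift[of "\<lambda>i. frob i x" r] by (simp add: trace_to_prime_def algebra_simps)
  also have "\<dots> = trace_to_prime r x" using assms by (simp add: subfldD)
  finally show ?thesis by (simp add: subfld_def)
qed

text \<open>Meaningful only on the prime field; elsewhere the \<open>LEAST\<close> is unspecified.\<close>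

definition add_char :: "'a::field_prime_char \<Rightarrow> complex" where
  "add_char x = cis (2 * pi * real (LEAST n. of_nat n = x) / real CHAR('a))"

lemma add_char_of_nat:
  "add_char (of_nat n :: 'a::field_prime_char) = cis (2 * pi * real n / real CHAR('a))"
proof -
  define k where "k = (LEAST k. of_nat k = (of_nat n :: 'a))"
  have "of_nat k = (of_nat n :: 'a)" unfolding k_def by (rule LeastI) simp
  then have "[int k = int n] (mod int CHAR('a))"
    by (simp add: of_nat_eq_iff_cong_CHAR cong_int_iff)
  then obtain t where t: "int n = int k + int CHAR('a) * t"
    by (auto simp: cong_iff_lin)
  then have "real n = real k + real CHAR('a) * of_int t"
    by (metis of_int_add of_int_mult of_int_of_nat_eq)
  then have "cis (2 * pi * real n / real CHAR('a)) = cis (2 * pi * real k / real CHAR('a)) * cis (2 * pi * t)"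
    by (simp add: cis_mult add_divide_distrib distrib_left mult.assoc)
  also have "cis (2 * pi * t) = 1" by (rule cis_multiple_2pi) auto
  finally show ?thesis by (simp add: add_char_def k_def)
qed

lemma add_char_of_int:
  "add_char (of_int k :: 'a::field_prime_char) = cis (2 * pi * of_int k / real CHAR('a))"
proof -
  define n where "n = nat (k mod int CHAR('a))"
  have "[k = int n] (mod int CHAR('a))"
    by (simp add: n_def cong_def)
  then have "of_int k = (of_nat n :: 'a)"
    using of_int_eq_iff_cong_CHAR[of k "int n", where ?'a = 'a] by simp
  moreover obtain t where "k = int n + int CHAR('a) * t"
    using \<open>[k = int n] (mod _)\<close> by (metis cong_iff_lin cong_sym)
  then have "real_of_int k = real n + real CHAR('a) * of_int t"
    by simp
  then have "cis (2 * pi * of_int k / real CHAR('a)) = cis (2 * pi * real n / real CHAR('a)) * cis (2 * pi * t)"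
    by (simp add: cis_mult add_divide_distrib distrib_left mult.assoc)
  moreover have "cis (2 * pi * t) = 1" by (rule cis_multiple_2pi) auto
  ultimately show ?thesis by (simp add: add_char_of_nat)
qed

context
  fixes x y :: "'a::{alg_closed_field,field_prime_char}"
  assumes x: "x \<in> subfld 1"
begin

lemma add_char_add:
  assumes "y \<in> subfld 1" shows "add_char (x + y) = add_char x * add_char y"
proof -
  obtain m n where "x = of_nat m" "y = of_nat n"
    using x assms unfolding prime_subfld_eq by auto
  then have "x + y = of_nat (m + n)" by simp
  with \<open>x = _\<close> \<open>y = _\<close> show ?thesis
    by (simp only: add_char_of_nat) (simp add: cis_mult add_divide_distrib distrib_left)
qed

lemma add_char_neq_1:
  assumes "x \<noteq> 0" shows "add_char x \<noteq> 1"
proof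
  assume eq: "add_char x = 1"
  obtain n where n: "x = of_nat n" "n < CHAR('a)" using x unfolding prime_subfld_eq by auto
  with assms have "n > 0" by (cases n) auto
  from eq n have "cis (2 * pi * real n / real CHAR('a)) = 1" by (simp add: add_char_of_nat)
  then have "cos (2 * pi * real n / real CHAR('a)) = 1" by (metis cis.sel(1) one_complex.sel(1))
  then obtain k :: int where "2 * pi * real n / real CHAR('a) = of_int k * (2 * pi)"
    by (auto simp: cos_one_2pi_int)
  then have "real n = of_int k * real CHAR('a)"
    by (simp add: field_simps)
  then have "int n = k * int CHAR('a)" by (metis of_int_eq_iff of_int_mult of_int_of_nat_eq)
  then have "CHAR('a) dvd n" by (metis dvd_triv_right int_dvd_int_iff)
  with n \<open>n > 0\<close> show False by (simp add: nat_dvd_not_less)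
qed

end

lemma norm_add_char [simp]: "cmod (add_char x) = 1"
  by (simp add: add_char_def)

lemma add_char_0 [simp]: "add_char 0 = 1"
  using add_char_of_nat[of 0] by simp

section \<open>Stepanov's method\<close>

text \<open>
  Substituting \<open>z = x ^ e * y\<close> into \<open>y ^ p = y + f(x)\<close> clears the pole of \<open>f\<close> at \<open>0\<close>. Giving \<open>x\<close> weight
  \<open>p\<close> and \<open>z\<close> weight \<open>d\<close>, the monomials \<open>x ^ i * z ^ j\<close> with \<open>j < p\<close> have distinct weights, so they are
  indexed by weight; the weight is the pole order at infinity.
\<close>

locale artin_schreier_curve =
  fixes F :: "'a::{alg_closed_field,field_prime_char} poly" and p d e r :: nat
  assumes p: "p = CHAR('a)" and d: "d = degree F" and r: "r > 0"
    and coeffs_F: "\<And>i. coeff F i \<in> subfld r"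
    and deg: "\<not> p dvd d"
    and e: "p * e < d"
begin

text \<open>If \<open>F\<close> is \<open>x ^ (e * p)\<close> times a Laurent polynomial g, then
  \<open>z = x ^ e * y\<close> turns \<open>y ^ p = y + g(x)\<close> into this equation. All points
  over the closed field are included; rational ones are selected by \<open>subfld r\<close>.\<close>

definition curve :: "('a \<times> 'a) set" where
  "curve = {(x, z). z ^ p = x ^ (e * (p - 1)) * z + poly F x}"

definition weights :: "nat set" where
  "weights = {w. \<exists>i j. j < p \<and> w = p * i + d * j}"

definition x_exp :: "nat \<Rightarrow> nat" where
  "x_exp w = (THE i. \<exists>j<p. w = p * i + d * j)"

definition z_exp :: "nat \<Rightarrow> nat" where
  "z_exp w = (THE j. j < p \<and> (\<exists>i. w = p * i + d * j))"

definition basis :: "nat \<Rightarrow> 'a \<times> 'a \<Rightarrow> 'a" where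
  "basis w = (\<lambda>(x, z). x ^ x_exp w * z ^ z_exp w)"

lemma p_gt_1: "p > 1" unfolding p by (rule CHAR_gt_1)

lemma d_pos: "d > 0" using deg by (cases "d = 0") auto

lemma coprime_p_d: "coprime p d"
  using deg prime_CHAR_field[where ?'a = 'a] by (simp add: p prime_imp_coprime)

text \<open>As \<open>d\<close> is invertible modulo \<open>p\<close>, the residue of the weight
  fixes \<open>j\<close>, and then \<open>i\<close>.\<close>

lemma weight_unique:
  assumes "p * i + d * j = p * i' + d * j'" "j < p" "j' < p"
  shows "i = i' \<and> j = j'"
proof -
  have "[d * j = d * j'] (mod p)"
    using arg_cong[OF assms(1), of "\<lambda>w. w mod p"] unfolding unique_euclidean_semiring_class.cong_def by simp
  then have "[j = j'] (mod p)"
    using coprime_p_d by (simp add: cong_mult_lcancel_nat coprime_commute)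
  with assms have "j = j'" by (simp add: cong_less_modulus_unique_nat)
  with assms p_gt_1 show ?thesis by simp
qed

lemma exps_eq:
  assumes "j < p"
  shows "x_exp (p * i + d * j) = i" "z_exp (p * i + d * j) = j"
proof -
  show "x_exp (p * i + d * j) = i"
    unfolding x_exp_def using assms weight_unique by (intro the_equality) blast+
  show "z_exp (p * i + d * j) = j"
    unfolding z_exp_def using assms weight_unique by (intro the_equality) blast+
qed

lemma weights_exps:
  assumes "w \<in> weights" shows "z_exp w < p" "w = p * x_exp w + d * z_exp w"
  using assms exps_eq by (auto simp: weights_def)

text \<open>This plays the role of Riemann's inequality: every number from \<open>d * p\<close> on
  is a weight, so the number of basis functions of weight at most \<open>n\<close> is
  \<open>n\<close> up to a bounded defect. The witness solves \<open>d * j = w\<close> modulo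
  \<open>p\<close> with \<open>j < p\<close>; then \<open>w \<ge> d * p\<close> leaves a nonnegative
  multiple of \<open>p\<close>.\<close>

lemma weights_ge:
  assumes "w \<ge> d * p" shows "w \<in> weights"
proof -
  obtain c where c: "[d * c = 1] (mod p)"
    using coprime_p_d cong_solve_coprime_nat[of d p] by (auto simp: coprime_commute)
  define j where "j = (c * w) mod p"
  have j: "j < p" using p_gt_1 by (simp add: j_def)
  have "[d * j = d * (c * w)] (mod p)"
    unfolding j_def unique_euclidean_semiring_class.cong_def by (simp add: mod_mult_right_eq)
  also have "[d * (c * w) = 1 * w] (mod p)"
    using cong_scalar_right[OF c, of w] by (simp add: mult.assoc)
  finally have "[d * j = w] (mod p)" by simp
  moreover have "d * j \<le> w"
    using j assms by (meson le_trans less_imp_le mult_le_mono2)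
  ultimately have "p dvd w - d * j"
    by (simp add: cong_altdef_nat cong_sym_eq)
  then obtain i where "w - d * j = p * i" by (elim dvdE)
  then have "w = d * j + p * i" using \<open>d * j \<le> w\<close> by simp
  with j show ?thesis unfolding weights_def by (auto simp: add.commute)
qed

lemma basis_monomial: "j < p \<Longrightarrow> basis (p * i + d * j) = (\<lambda>(x, z). x ^ i * z ^ j)"
  by (simp add: basis_def exps_eq)

section \<open>The filtration of functions on the curve by weight\<close>

definition span_lt :: "nat \<Rightarrow> ('a \<times> 'a \<Rightarrow> 'a) set" where
  "span_lt n = {f. \<exists>c. (\<forall>w. c w \<in> subfld r) \<and>
     (\<forall>P\<in>curve. f P = (\<Sum>w\<in>weights \<inter> {..<n}. c w * basis w P))}"

text \<open>The functions with leading weight \<open>n\<close>. Tracking the leading term takes the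
  place of linear independence of the \<open>basis\<close> functions on the curve: that such a
  function cannot vanish too often is extracted from its leading coefficient later.\<close>

definition exact :: "nat \<Rightarrow> ('a \<times> 'a \<Rightarrow> 'a) set" where
  "exact n = {f. n \<in> weights \<and> (\<exists>c\<in>subfld r - {0}. (\<lambda>P. f P - c * basis n P) \<in> span_lt n)}"

lemma span_ltI:
  assumes "\<And>w. c w \<in> subfld r" "\<And>P. P \<in> curve \<Longrightarrow> f P = (\<Sum>w\<in>weights \<inter> {..<n}. c w * basis w P)"
  shows "f \<in> span_lt n"
  using assms by (auto simp: span_lt_def)

lemma span_lt_zero: "(\<lambda>_. 0) \<in> span_lt n"
  by (rule span_ltI[of "\<lambda>_. 0"]) auto

lemma span_lt_add:
  assumes "f \<in> span_lt n" "g \<in> span_lt n" shows "(\<lambda>P. f P + g P) \<in> span_lt n"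
proof -
  from assms obtain c c' where "\<forall>w. c w \<in> subfld r" "\<forall>w. c' w \<in> subfld r"
    "\<forall>P\<in>curve. f P = (\<Sum>w\<in>weights \<inter> {..<n}. c w * basis w P)"
    "\<forall>P\<in>curve. g P = (\<Sum>w\<in>weights \<inter> {..<n}. c' w * basis w P)"
    unfolding span_lt_def by blast
  then show ?thesis
    by (intro span_ltI[of "\<lambda>w. c w + c' w"]) (auto simp: subfld_add sum.distrib distrib_right)
qed

lemma span_lt_scale:
  assumes "f \<in> span_lt n" "a \<in> subfld r" shows "(\<lambda>P. a * f P) \<in> span_lt n"
proof -
  from assms obtain c where "\<forall>w. c w \<in> subfld r"
    "\<forall>P\<in>curve. f P = (\<Sum>w\<in>weights \<inter> {..<n}. c w * basis w P)"
    unfolding span_lt_def by blast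
  then show ?thesis using assms
    by (intro span_ltI[of "\<lambda>w. a * c w"]) (auto simp: subfld_mult sum_distrib_left mult.assoc)
qed

lemma span_lt_sum:
  assumes "\<And>i. i \<in> I \<Longrightarrow> f i \<in> span_lt n" shows "(\<lambda>P. \<Sum>i\<in>I. f i P) \<in> span_lt n"
  using assms by (induction I rule: infinite_finite_induct) (auto intro: span_lt_zero span_lt_add)

lemma span_lt_cong:
  assumes "f \<in> span_lt n" "\<And>P. P \<in> curve \<Longrightarrow> g P = f P" shows "g \<in> span_lt n"
  using assms by (auto simp: span_lt_def)

lemma span_lt_mono:
  assumes "f \<in> span_lt m" "m \<le> n" shows "f \<in> span_lt n"
proof -
  from assms obtain c where c: "\<forall>w. c w \<in> subfld r"
    "\<forall>P\<in>curve. f P = (\<Sum>w\<in>weights \<inter> {..<m}. c w * basis w P)"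
    unfolding span_lt_def by blast
  show ?thesis
  proof (rule span_ltI[of "\<lambda>w. if w < m then c w else 0"])
    fix P assume "P \<in> curve"
    then show "f P = (\<Sum>w\<in>weights \<inter> {..<n}. (if w < m then c w else 0) * basis w P)"
      using c assms(2) by (auto intro!: sum.mono_neutral_cong_left split: if_splits)
  qed (use c in auto)
qed

lemma basis_span_lt:
  assumes "w \<in> weights" "w < n" shows "basis w \<in> span_lt n"
proof (rule span_ltI[of "\<lambda>v. if v = w then 1 else 0"])
  fix P
  have "(\<Sum>v\<in>weights \<inter> {..<n}. (if v = w then 1 else 0) * basis v P) =
     (\<Sum>v\<in>weights \<inter> {..<n}. if v = w then basis v P else 0)"
    by (intro sum.cong) auto
  then show "basis w P = (\<Sum>v\<in>weights \<inter> {..<n}. (if v = w then 1 else 0) * basis v P)"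
    using assms by simp
qed auto

lemma exactD:
  assumes "f \<in> exact n"
  obtains c g where "n \<in> weights" "c \<in> subfld r" "c \<noteq> 0" "g \<in> span_lt n" "f = (\<lambda>P. c * basis n P + g P)"
proof -
  from assms obtain c where c: "n \<in> weights" "c \<in> subfld r - {0}" "(\<lambda>P. f P - c * basis n P) \<in> span_lt n"
    unfolding exact_def by blast
  show ?thesis by (rule that[OF c(1) _ _ c(3)]) (use c in auto)
qed

lemma exactI:
  assumes "n \<in> weights" "c \<in> subfld r" "c \<noteq> 0" "g \<in> span_lt n"
    "\<And>P. P \<in> curve \<Longrightarrow> f P = c * basis n P + g P"
  shows "f \<in> exact n"
  unfolding exact_def using assms by (auto intro!: bexI[of _ c] intro: span_lt_cong[OF assms(4)])

lemma exact_span_lt: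
  assumes "f \<in> exact n" "n < m" shows "f \<in> span_lt m"
  using assms(1)
proof (rule exactD)
  fix c g assume *: "n \<in> weights" "c \<in> subfld r" "g \<in> span_lt n" "f = (\<lambda>P. c * basis n P + g P)"
  with assms show ?thesis
    by (auto intro!: span_lt_add span_lt_scale basis_span_lt span_lt_mono[of g n m])
qed

lemma exact_add:
  assumes "f \<in> exact n" "g \<in> span_lt n" shows "(\<lambda>P. f P + g P) \<in> exact n"
  using assms(1)
proof (rule exactD)
  fix c h assume *: "n \<in> weights" "c \<in> subfld r" "c \<noteq> 0" "h \<in> span_lt n" "f = (\<lambda>P. c * basis n P + h P)"
  then show ?thesis using span_lt_add[OF *(4) assms(2)]
    by (intro exactI[of n c "\<lambda>P. h P + g P"]) auto
qed

lemma exact_scale: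
  assumes "f \<in> exact n" "a \<in> subfld r" "a \<noteq> 0" shows "(\<lambda>P. a * f P) \<in> exact n"
  using assms(1)
proof (rule exactD)
  fix c h assume *: "n \<in> weights" "c \<in> subfld r" "c \<noteq> 0" "h \<in> span_lt n" "f = (\<lambda>P. c * basis n P + h P)"
  then show ?thesis using span_lt_scale[OF *(4) assms(2)] assms
    by (intro exactI[of n "a * c" "\<lambda>P. a * h P"]) (auto simp: algebra_simps subfld_mult)
qed

lemma exact_cong:
  assumes "f \<in> exact n" "\<And>P. P \<in> curve \<Longrightarrow> g P = f P" shows "g \<in> exact n"
  using assms(1)
proof (rule exactD)
  fix c h assume *: "n \<in> weights" "c \<in> subfld r" "c \<noteq> 0" "h \<in> span_lt n" "f = (\<lambda>P. c * basis n P + h P)"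
  then show ?thesis using assms(2) by (intro exactI[of n c h]) auto
qed

lemma basis_exact: "n \<in> weights \<Longrightarrow> basis n \<in> exact n"
  by (rule exactI[of n 1 "\<lambda>_. 0"]) (auto simp: span_lt_zero)

text \<open>A power \<open>z ^ p\<close> is replaced by means of the curve equation. The top term of
  \<open>F\<close> has weight \<open>p * d\<close>, exactly that of \<open>z ^ p\<close>, so the
  weight is preserved; the lower terms of \<open>F\<close> weigh less. The term
  \<open>x ^ (e * (p - 1)) * z\<close> weighs \<open>p * e * (p - 1) + d\<close>, which is below
  \<open>d * p\<close> because \<open>p * e < d\<close>.\<close>

lemma monomial_exact: "(\<lambda>(x, z). x ^ a * z ^ b) \<in> exact (p * a + d * b)"
proof (induction b arbitrary: a rule: less_induct)
  case (less b)
  show ?case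
  proof (cases "b < p")
    case True
    then have "p * a + d * b \<in> weights" by (auto simp: weights_def)
    from basis_exact[OF this] show ?thesis by (simp add: basis_monomial True)
  next
    case False
    define b' where "b' = b - p"
    have b: "b = b' + p" using False by (simp add: b'_def)
    have F0: "F \<noteq> 0" using d_pos d by auto
    let ?w = "p * a + d * b"
    let ?m = "\<lambda>a b (x::'a, z::'a). x ^ a * z ^ b"
    have top: "?m (a + d) b' \<in> exact ?w"
      using less.IH[of b' "a + d"] p_gt_1 by (simp add: b algebra_simps)
    have low: "?m (a + i) b' \<in> span_lt ?w" if "i < d" for i
      using less.IH[of b' "a + i"] that p_gt_1 by (rule_tac exact_span_lt) (auto simp: b algebra_simps)
    have lin: "?m (a + e * (p - 1)) (b' + 1) \<in> span_lt ?w"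
    proof (rule exact_span_lt)
      show "?m (a + e * (p - 1)) (b' + 1) \<in> exact (p * (a + e * (p - 1)) + d * (b' + 1))"
        using p_gt_1 by (intro less.IH) (simp add: b)
      have "p * e * (p - 1) + d < d * (p - 1) + d"
        using e p_gt_1 by simp
      also have "d * (p - 1) + d = d * p" using p_gt_1 by (cases p) auto
      finally have "p * e * (p - 1) + d < d * p" .
      moreover have "p * (a + e * (p - 1)) + d * (b' + 1) = (p * a + d * b') + (p * e * (p - 1) + d)"
        by (simp add: distrib_left mult.assoc)
      moreover have "?w = (p * a + d * b') + d * p" by (simp add: b distrib_left)
      ultimately show "p * (a + e * (p - 1)) + d * (b' + 1) < ?w" by linarith
    qed
    have "(\<lambda>P. lead_coeff F * ?m (a + d) b' P +
             (?m (a + e * (p - 1)) (b' + 1) P + (\<Sum>i<d. coeff F i * ?m (a + i) b' P))) \<in> exact ?w"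
      using F0 by (intro exact_add exact_scale[OF top] span_lt_add lin span_lt_sum span_lt_scale low)
        (auto simp: coeffs_F)
    then show ?thesis
    proof (rule exact_cong)
      fix P assume P: "P \<in> curve"
      obtain x z where [simp]: "P = (x, z)" by (cases P)
      have z: "z ^ p = x ^ (e * (p - 1)) * z + poly F x" using P by (simp add: curve_def)
      have F: "poly F x = lead_coeff F * x ^ d + (\<Sum>i<d. coeff F i * x ^ i)"
        unfolding poly_altdef by (simp add: d lessThan_Suc_atMost[symmetric] add.commute)
      have "x ^ a * z ^ b = x ^ a * z ^ b' * z ^ p" by (simp add: b power_add)
      also have "\<dots> = lead_coeff F * (x ^ (a + d) * z ^ b') +
             (x ^ (a + e * (p - 1)) * z ^ (b' + 1) + (\<Sum>i<d. coeff F i * (x ^ (a + i) * z ^ b')))"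
        unfolding z F by (simp add: algebra_simps power_add sum_distrib_left sum_distrib_right)
      finally show "?m a b P = lead_coeff F * ?m (a + d) b' P +
             (?m (a + e * (p - 1)) (b' + 1) P + (\<Sum>i<d. coeff F i * ?m (a + i) b' P))" by simp
    qed
  qed
qed

lemma basis_mult_exact:
  assumes "m \<in> weights" "n \<in> weights" shows "(\<lambda>P. basis m P * basis n P) \<in> exact (m + n)"
proof -
  have "p * (x_exp m + x_exp n) + d * (z_exp m + z_exp n) = m + n"
    using weights_exps(2)[OF assms(1)] weights_exps(2)[OF assms(2)] by (simp add: algebra_simps)
  with monomial_exact[of "x_exp m + x_exp n" "z_exp m + z_exp n"] show ?thesis
    by (auto simp: basis_def power_add case_prod_unfold algebra_simps)
qed

text \<open>The asymmetry is deliberate: weight at most \<open>m\<close> times weight below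
  \<open>n\<close> stays below \<open>m + n\<close>, which is what products of leading and lower
  terms require.\<close>

lemma span_lt_mult:
  assumes "f \<in> span_lt (Suc m)" "g \<in> span_lt n" shows "(\<lambda>P. f P * g P) \<in> span_lt (m + n)"
proof -
  from assms obtain c c' where c: "\<forall>w. c w \<in> subfld r" "\<forall>w. c' w \<in> subfld r"
    "\<forall>P\<in>curve. f P = (\<Sum>w\<in>weights \<inter> {..<Suc m}. c w * basis w P)"
    "\<forall>P\<in>curve. g P = (\<Sum>w\<in>weights \<inter> {..<n}. c' w * basis w P)"
    unfolding span_lt_def by blast
  have "(\<lambda>P. \<Sum>w\<in>weights \<inter> {..<Suc m}. \<Sum>v\<in>weights \<inter> {..<n}. c w * c' v * (basis w P * basis v P)) \<in> span_lt (m + n)"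
    using c by (intro span_lt_sum span_lt_scale exact_span_lt[OF basis_mult_exact]) (auto simp: subfld_mult)
  then show ?thesis
  proof (rule span_lt_cong)
    fix P assume "P \<in> curve"
    with c have "f P * g P = (\<Sum>w\<in>weights \<inter> {..<Suc m}. c w * basis w P) * (\<Sum>w\<in>weights \<inter> {..<n}. c' w * basis w P)"
      by metis
    then show "f P * g P = (\<Sum>w\<in>weights \<inter> {..<Suc m}. \<Sum>v\<in>weights \<inter> {..<n}. c w * c' v * (basis w P * basis v P))"
      by (simp only: sum_product mult.assoc mult.left_commute)
  qed
qed

lemma exact_mult:
  assumes "f \<in> exact m" "g \<in> exact n" shows "(\<lambda>P. f P * g P) \<in> exact (m + n)"
proof -
  obtain c f' where f: "m \<in> weights" "c \<in> subfld r" "c \<noteq> 0" "f' \<in> span_lt m" "f = (\<lambda>P. c * basis m P + f' P)"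
    using assms(1) by (rule exactD)
  obtain c' g' where g: "n \<in> weights" "c' \<in> subfld r" "c' \<noteq> 0" "g' \<in> span_lt n" "g = (\<lambda>P. c' * basis n P + g' P)"
    using assms(2) by (rule exactD)
  have 1: "(\<lambda>P. c * basis m P * g' P) \<in> span_lt (m + n)"
    using f g by (intro span_lt_mult span_lt_scale basis_span_lt) auto
  have 2: "(\<lambda>P. g P * f' P) \<in> span_lt (n + m)"
    using f assms by (intro span_lt_mult exact_span_lt[of g n]) auto
  have "(\<lambda>P. (c * c') * (basis m P * basis n P) + (c * basis m P * g' P + g P * f' P)) \<in> exact (m + n)"
    using f g 1 2 by (intro exact_add exact_scale basis_mult_exact span_lt_add) (auto simp: subfld_mult add.commute)
  then show ?thesis
    by (rule exact_cong) (simp add: f(5) g(5) algebra_simps)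
qed

lemma zero_weight: "0 \<in> weights"
  unfolding weights_def using p_gt_1 by (auto intro!: exI[of _ 0])

lemma basis_power_exact:
  assumes "w \<in> weights" shows "(\<lambda>P. basis w P ^ k) \<in> exact (k * w)"
proof (induction k)
  case 0
  show ?case using basis_exact[OF zero_weight] basis_monomial[of 0 0] p_gt_1 by (simp add: case_prod_unfold)
next
  case (Suc k)
  from exact_mult[OF basis_exact[OF assms] this] show ?case by simp
qed

text \<open>Among the terms with nonzero coefficient exactly one has the largest weight, and nothing
  can cancel it.\<close>

lemma exact_sum_distinct:
  assumes "finite I" "inj_on h I" "\<And>i. i \<in> I \<Longrightarrow> f i \<in> exact (h i)"
    "\<And>i. i \<in> I \<Longrightarrow> g i \<in> subfld r" "i0 \<in> I" "g i0 \<noteq> 0"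
  shows "\<exists>i\<in>I. (\<lambda>P. \<Sum>i\<in>I. g i * f i P) \<in> exact (h i)"
proof -
  define J where "J = {i \<in> I. g i \<noteq> 0}"
  have J: "finite J" "J \<noteq> {}" using assms by (auto simp: J_def)
  define w where "w = Max (h ` J)"
  have "w \<in> h ` J" unfolding w_def using J by (intro Max_in) auto
  then obtain k where k: "k \<in> J" "w = h k" by blast
  have less: "h i < h k" if "i \<in> J - {k}" for i
  proof -
    have "h i \<le> w" unfolding w_def using J that by (intro Max_ge) auto
    moreover have "h i \<noteq> h k" using assms(2) that k by (auto simp: inj_on_def J_def)
    ultimately show ?thesis using k by simp
  qed
  have low: "f i \<in> span_lt (h k)" if "i \<in> J - {k}" for i
    using that by (intro exact_span_lt[OF assms(3) less]) (auto simp: J_def)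
  have "(\<lambda>P. g k * f k P + (\<Sum>i\<in>J - {k}. g i * f i P)) \<in> exact (h k)"
    using k assms low
    by (intro exact_add exact_scale span_lt_sum span_lt_scale) (auto simp: J_def)
  then have "(\<lambda>P. \<Sum>i\<in>I. g i * f i P) \<in> exact (h k)"
  proof (rule exact_cong)
    fix P
    have "(\<Sum>i\<in>I. g i * f i P) = (\<Sum>i\<in>J. g i * f i P)"
      using assms(1) by (intro sum.mono_neutral_right) (auto simp: J_def)
    also have "\<dots> = g k * f k P + (\<Sum>i\<in>J - {k}. g i * f i P)"
      using J k by (subst sum.remove[of _ k]) auto
    finally show "(\<Sum>i\<in>I. g i * f i P) = g k * f k P + (\<Sum>i\<in>J - {k}. g i * f i P)" .
  qed
  with k show ?thesis by (auto simp: J_def)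
qed


section \<open>Stepanov's auxiliary function and the point count\<close>

lemma weights_card:
  assumes "d * p \<le> n" shows "n + 1 - d * p \<le> card (weights \<inter> {..n})"
proof -
  have "{d * p..n} \<subseteq> weights \<inter> {..n}" using weights_ge by auto
  from card_mono[OF _ this] show ?thesis by simp
qed

text \<open>
  The fibre over a point \<open>x\<close> of \<open>A\<close> consists of the \<open>p\<close> points \<open>z + c * x ^ e\<close>. A function without
  powers of \<open>z\<close> beyond \<open>p - 1\<close> that vanishes on it has all its coefficients vanishing at \<open>x\<close>.
\<close>

lemma combination_nonzero_imp_few_zeros:
  assumes "f \<in> exact w" "A \<subseteq> subfld r - {0}"
    and fiber: "\<And>x. x \<in> A \<Longrightarrow> \<exists>z\<in>subfld r. (x, z) \<in> curve"
    and zero: "\<And>x z. (x, z) \<in> curve \<Longrightarrow> x \<in> subfld r \<Longrightarrow> z \<in> subfld r \<Longrightarrow> f (x, z) = 0"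
  shows "p * card A \<le> w"
proof -
  obtain c g where w: "w \<in> weights" and c: "c \<noteq> 0" and g: "g \<in> span_lt w"
    and f: "f = (\<lambda>P. c * basis w P + g P)"
    using assms(1) by (rule exactD)
  from g obtain h where h: "\<And>P. P \<in> curve \<Longrightarrow> g P = (\<Sum>v\<in>weights \<inter> {..<w}. h v * basis v P)"
    unfolding span_lt_def by blast
  define h' where "h' v = (if v = w then c else h v)" for v
  define I where "I = weights \<inter> {..w}"
  have I: "finite I" "w \<in> I" "I = insert w (weights \<inter> {..<w})" using w by (auto simp: I_def)
  have f_eq: "f P = (\<Sum>v\<in>I. h' v * basis v P)" if "P \<in> curve" for P
  proof -
    have "(\<Sum>v\<in>I. h' v * basis v P) = c * basis w P + (\<Sum>v\<in>weights \<inter> {..<w}. h' v * basis v P)"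
      unfolding I(3) by (subst sum.insert) (auto simp: h'_def)
    also have "(\<Sum>v\<in>weights \<inter> {..<w}. h' v * basis v P) = g P"
      unfolding h[OF that] by (intro sum.cong) (auto simp: h'_def)
    finally show ?thesis by (simp add: f)
  qed
  \<comment> \<open>The coefficient of \<open>z ^ j\<close> in \<open>f\<close>, as a polynomial in
    \<open>x\<close>.\<close>
  define G where "G j = (\<Sum>v | v \<in> I \<and> z_exp v = j. monom (h' v) (x_exp v))" for j
  have G_zero: "poly (G j) x = 0" if "x \<in> A" "j < p" for x j
  proof -
    obtain z where z: "z \<in> subfld r" "(x, z) \<in> curve" using fiber[OF \<open>x \<in> A\<close>] by blast
    have x: "x \<in> subfld r" "x \<noteq> 0" using that assms(2) by auto
    define B where "B = (\<Sum>j<p. monom (poly (G j) x) j)"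
    have B: "poly B y = f (x, y)" if "(x, y) \<in> curve" for y
    proof -
      have "poly B y = (\<Sum>j<p. \<Sum>v | v \<in> I \<and> z_exp v = j. h' v * basis v (x, y))"
        by (auto simp: B_def G_def poly_sum poly_monom basis_def sum_distrib_right mult.assoc intro!: sum.cong)
      also have "\<dots> = (\<Sum>v\<in>I. h' v * basis v (x, y))"
        by (rule sum.group) (use I(1) weights_exps(1) in \<open>auto simp: I_def\<close>)
      finally show ?thesis by (simp add: f_eq that)
    qed
    let ?Z = "(\<lambda>c. z + c * x ^ e) ` (subfld 1 :: 'a set)"
    have "poly B y = 0" if "y \<in> ?Z" for y
    proof -
      obtain c where c: "c \<in> subfld 1" "y = z + c * x ^ e" using \<open>y \<in> ?Z\<close> by blast
      have "y ^ p = z ^ p + c ^ p * x ^ (e * p)"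
        unfolding c(2) p by (subst freshmans_dream) (auto simp: power_mult_distrib power_mult)
      moreover have "c ^ p = c" using c(1) by (simp add: subfld_def frob_def p)
      moreover have "e * p = e * (p - 1) + e" using p_gt_1 by (cases p) auto
      then have "x ^ (e * p) = x ^ (e * (p - 1)) * x ^ e" by (simp only: power_add)
      moreover have "z ^ p = x ^ (e * (p - 1)) * z + poly F x" using z(2) by (simp add: curve_def)
      ultimately have "y ^ p = x ^ (e * (p - 1)) * z + poly F x + c * (x ^ (e * (p - 1)) * x ^ e)"
        by simp
      also have "\<dots> = x ^ (e * (p - 1)) * y + poly F x"
        unfolding c(2) by (simp only: distrib_left mult.left_commute add_ac)
      finally have "y ^ p = x ^ (e * (p - 1)) * y + poly F x" .
      then have "(x, y) \<in> curve" by (simp add: curve_def)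
      moreover have "y \<in> subfld r"
        unfolding c(2) using subfld_1_subset[OF c(1)] z x by (intro subfld_add subfld_mult subfld_power)
      ultimately show ?thesis using B zero x by auto
    qed
    moreover have "card ?Z = p"
      using x by (subst card_image) (auto simp: inj_on_def card_subfld p)
    moreover have "degree B < p"
      unfolding B_def using p_gt_1
      by (intro degree_sum_less) (auto intro: le_less_trans[OF degree_monom_le])
    ultimately have "B = 0"
      by (intro poly_eqI_degree[of ?Z]) (use p_gt_1 in auto)
    moreover have "coeff B j = poly (G j) x"
      using that(2) by (simp add: B_def coeff_sum)
    ultimately show ?thesis by simp
  qed
  \<comment> \<open>A weight is determined by its two exponents, so no other term of
    \<open>f\<close> reaches this coefficient, and the leading coefficient \<open>c\<close>
    survives.\<close>
  have "coeff (G (z_exp w)) (x_exp w) = (\<Sum>v | v \<in> I \<and> z_exp v = z_exp w. if x_exp v = x_exp w then h' v else 0)"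
    by (simp add: G_def coeff_sum)
  also have "\<dots> = (\<Sum>v | v \<in> I \<and> z_exp v = z_exp w. if v = w then h' v else 0)"
  proof (intro sum.cong refl)
    fix v assume "v \<in> {v \<in> I. z_exp v = z_exp w}"
    then have v: "v \<in> weights" "z_exp v = z_exp w" by (auto simp: I_def)
    have "x_exp v = x_exp w \<longleftrightarrow> v = w"
      by (metis weights_exps(2)[OF v(1)] weights_exps(2)[OF w] v(2))
    then show "(if x_exp v = x_exp w then h' v else 0) = (if v = w then h' v else 0)" by simp
  qed
  also have "\<dots> = c" using I by (simp add: h'_def)
  finally have nz: "G (z_exp w) \<noteq> 0" using c by auto
  have "p * degree (G (z_exp w)) \<le> w"
  proof -
    have "degree (G (z_exp w)) \<le> w div p"
      unfolding G_def
    proof (rule degree_sum_le)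
      fix v assume "v \<in> {v \<in> I. z_exp v = z_exp w}"
      then have "v \<in> weights" "v \<le> w" by (auto simp: I_def)
      with weights_exps(2)[of v] have "p * x_exp v \<le> w" by linarith
      then have "x_exp v \<le> w div p" using p_gt_1 by (simp add: less_eq_div_iff_mult_less_eq mult.commute)
      then show "degree (monom (h' v) (x_exp v)) \<le> w div p"
        using degree_monom_le le_trans by blast
    qed (use I in auto)
    then have "p * degree (G (z_exp w)) \<le> p * (w div p)" by simp
    also have "\<dots> \<le> w" by simp
    finally show ?thesis .
  qed
  moreover have "card A \<le> degree (G (z_exp w))"
  proof -
    have "card A \<le> card {x. poly (G (z_exp w)) x = 0}"
      using G_zero weights_exps(1)[OF w] by (intro card_mono poly_roots_finite nz) auto
    also have "\<dots> \<le> degree (G (z_exp w))" by (rule card_poly_roots_bound[OF nz])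
    finally show ?thesis .
  qed
  ultimately show ?thesis by (meson le_trans mult_le_mono2)
qed

text \<open>
  By the pigeonhole principle some nonzero combination \<open>\<Sum> g\<^sub>u\<^sub>v ^ P * b\<^sub>v ^ P * b\<^sub>u\<close> vanishes on the curve.
  Its \<open>Q\<close>-th power at points over the field of \<open>P * Q\<close> elements is \<open>\<Sum> g\<^sub>u\<^sub>v * b\<^sub>v * b\<^sub>u ^ Q\<close>, whose terms have
  distinct weights, so that this function is nonzero.
\<close>

lemma auxiliary_function_exists:
  fixes P Q l m :: nat
  assumes PQ: "P = p ^ s" "Q = p ^ t" "s + t = r" "l < Q"
    and dim: "l * P + m + 1 < card (weights \<inter> {..l}) * card (weights \<inter> {..m})"
  shows "\<exists>f w. f \<in> exact w \<and> w \<le> l + Q * m \<and>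
    (\<forall>x z. (x, z) \<in> curve \<longrightarrow> x \<in> subfld r \<longrightarrow> z \<in> subfld r \<longrightarrow> f (x, z) = 0)"
proof -
  define U where "U = weights \<inter> {..m}"
  define V where "V = weights \<inter> {..l}"
  define k where "k = (subfld r :: 'a set)"
  have k: "finite k" "card k > 1"
    using card_subfld[OF r, where ?'a = 'a] finite_subfld[OF r, where ?'a = 'a] one_less_power[OF p_gt_1 r]
    by (auto simp: k_def p)
  have fin: "finite U" "finite V" by (auto simp: U_def V_def)
  define C where "C = (U \<times> V \<rightarrow>\<^sub>E k)"
  \<comment> \<open>Raising to the power \<open>P\<close> is a power of Frobenius, so
    \<open>\<delta>\<close> is additive in \<open>c\<close>: two tables with the same image differ
    by one that yields the zero function.\<close>
  define \<delta> where "\<delta> c = (\<lambda>P'. \<Sum>(u, v)\<in>U \<times> V. c (u, v) ^ P * (basis v P' ^ P * basis u P'))" for c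
  have \<delta>_span: "\<delta> c \<in> span_lt (l * P + m + 1)" if "c \<in> C" for c
    unfolding \<delta>_def case_prod_unfold
  proof (intro span_lt_sum span_lt_scale)
    fix uv assume uv: "uv \<in> U \<times> V"
    then have "fst uv \<in> weights" "snd uv \<in> weights" "fst uv \<le> m" "snd uv \<le> l"
      by (auto simp: U_def V_def)
    then have "(\<lambda>P'. basis (snd uv) P' ^ P * basis (fst uv) P') \<in> exact (P * snd uv + fst uv)"
      by (intro exact_mult basis_power_exact basis_exact) auto
    moreover have "P * snd uv + fst uv < l * P + m + 1"
      using \<open>fst uv \<le> m\<close> \<open>snd uv \<le> l\<close> by (simp add: add_mono mult.commute le_imp_less_Suc)
    ultimately show "(\<lambda>P'. basis (snd uv) P' ^ P * basis (fst uv) P') \<in> span_lt (l * P + m + 1)"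
      by (rule exact_span_lt)
    show "c (fst uv, snd uv) ^ P \<in> subfld r"
      using that uv by (cases uv, intro subfld_power) (auto simp: C_def k_def PiE_iff)
  qed
  define W where "W = weights \<inter> {..<l * P + m + 1}"
  have "\<exists>a\<in>W \<rightarrow>\<^sub>E k. \<forall>P'\<in>curve. \<delta> c P' = (\<Sum>w\<in>W. a w * basis w P')" if c: "c \<in> C" for c
  proof -
    obtain a where "\<forall>w. a w \<in> subfld r" "\<forall>P'\<in>curve. \<delta> c P' = (\<Sum>w\<in>W. a w * basis w P')"
      using \<delta>_span[OF c] unfolding span_lt_def W_def by blast
    then show ?thesis
      by (intro bexI[of _ "restrict a W"]) (auto simp: k_def intro!: sum.cong)
  qed
  then obtain a where a: "\<And>c. c \<in> C \<Longrightarrow> a c \<in> W \<rightarrow>\<^sub>E k"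
    "\<And>c P'. c \<in> C \<Longrightarrow> P' \<in> curve \<Longrightarrow> \<delta> c P' = (\<Sum>w\<in>W. a c w * basis w P')"
    by metis
  \<comment> \<open>Additive in \<open>c\<close> but not linear, \<open>\<delta>\<close> is treated
    by counting elements instead of dimensions. This also allows an arbitrary choice of the
    coordinates \<open>a c\<close>.\<close>
  have "\<not> inj_on a C"
  proof
    assume inj: "inj_on a C"
    have finW: "finite W" by (simp add: W_def)
    have "card k ^ card (U \<times> V) = card C" using fin by (simp add: C_def card_funcsetE)
    also have "card C \<le> card (W \<rightarrow>\<^sub>E k)"
      using a(1) k finW by (intro card_inj_on_le[OF inj]) (auto intro!: finite_PiE)
    also have "\<dots> = card k ^ card W" using finW by (simp add: card_funcsetE)
    finally have "card (U \<times> V) \<le> card W" using k by (simp add: power_increasing_iff)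
    also have "\<dots> \<le> card {..<l * P + m + 1}" by (intro card_mono) (auto simp: W_def)
    finally show False using dim by (simp add: U_def V_def card_cartesian_product mult.commute)
  qed
  then obtain c c' where c: "c \<in> C" "c' \<in> C" "c \<noteq> c'" "a c = a c'" by (auto simp: inj_on_def)
  define g where "g uv = c uv - c' uv" for uv
  obtain uv0 where uv0: "uv0 \<in> U \<times> V" "g uv0 \<noteq> 0"
    using c unfolding C_def g_def by (metis PiE_ext right_minus_eq)
  have g: "g uv \<in> subfld r" if "uv \<in> U \<times> V" for uv
    using c that unfolding g_def C_def k_def by (intro subfld_diff) (auto simp: PiE_iff)
  define f where "f = (\<lambda>P'. \<Sum>uv\<in>U \<times> V. g uv * (basis (snd uv) P' * basis (fst uv) P' ^ Q))"
  have "\<exists>uv\<in>U \<times> V. f \<in> exact (snd uv + Q * fst uv)"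
    unfolding f_def
  proof (rule exact_sum_distinct[where h = "\<lambda>uv. snd uv + Q * fst uv"])
    \<comment> \<open>Since \<open>l < Q\<close>, the two components are the remainder and the
      quotient of the weight modulo \<open>Q\<close>.\<close>
    show "inj_on (\<lambda>uv. snd uv + Q * fst uv) (U \<times> V)"
    proof (rule inj_onI)
      fix x y assume xy: "x \<in> U \<times> V" "y \<in> U \<times> V" and eq: "snd x + Q * fst x = snd y + Q * fst y"
      have lt: "snd x < Q" "snd y < Q" using xy PQ by (auto simp: V_def)
      have "snd x = snd y" using arg_cong[OF eq, of "\<lambda>w. w mod Q"] lt by simp
      moreover have "fst x = fst y" using arg_cong[OF eq, of "\<lambda>w. w div Q"] lt by simp
      ultimately show "x = y" by (simp add: prod_eq_iff)
    qed
    show "(\<lambda>P. basis (snd i) P * basis (fst i) P ^ Q) \<in> exact (snd i + Q * fst i)" if "i \<in> U \<times> V" for i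
      using that by (intro exact_mult basis_power_exact basis_exact) (auto simp: U_def V_def)
  qed (use fin g uv0 in auto)
  then obtain uv where uv: "uv \<in> U \<times> V" "f \<in> exact (snd uv + Q * fst uv)" by blast
  have "f (x, z) = 0" if xz: "(x, z) \<in> curve" "x \<in> subfld r" "z \<in> subfld r" for x z
  proof -
    have "\<delta> c (x, z) = \<delta> c' (x, z)" using a(2)[OF c(1) xz(1)] a(2)[OF c(2) xz(1)] c(4) by simp
    then have "0 = \<delta> c (x, z) - \<delta> c' (x, z)" by simp
    also have "\<dots> = (\<Sum>uv\<in>U \<times> V. g uv ^ P * (basis (snd uv) (x, z) ^ P * basis (fst uv) (x, z)))"
      unfolding \<delta>_def case_prod_unfold sum_subtractf[symmetric]
      using frob_diff[of s "c _" "c' _"] by (intro sum.cong) (auto simp: g_def PQ frob_def p left_diff_distrib)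
    finally have "0 = (\<Sum>uv\<in>U \<times> V. g uv ^ P * (basis (snd uv) (x, z) ^ P * basis (fst uv) (x, z)))" .
    then have "0 = frob t (\<Sum>uv\<in>U \<times> V. frob s (g uv) * (frob s (basis (snd uv) (x, z)) * basis (fst uv) (x, z)))"
      by (simp add: frob_def PQ p)
    also have "\<dots> = (\<Sum>uv\<in>U \<times> V. g uv * (basis (snd uv) (x, z) * basis (fst uv) (x, z) ^ Q))"
      unfolding frob_sum
    proof (intro sum.cong refl)
      fix uv assume uv: "uv \<in> U \<times> V"
      have "basis (snd uv) (x, z) \<in> subfld r" using xz by (auto simp: basis_def intro!: subfld_mult subfld_power)
      moreover have "t + s = r" using PQ by simp
      ultimately show "frob t (frob s (g uv) * (frob s (basis (snd uv) (x, z)) * basis (fst uv) (x, z))) =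
          g uv * (basis (snd uv) (x, z) * basis (fst uv) (x, z) ^ Q)"
        using g[OF uv] by (simp add: frob_mult frob_frob subfldD) (simp add: frob_def PQ p)
    qed
    finally show ?thesis by (simp add: f_def)
  qed
  moreover have "snd uv + Q * fst uv \<le> l + Q * m" using uv by (auto simp: U_def V_def intro!: add_mono)
  ultimately show ?thesis using uv by blast
qed

text \<open>Halving \<open>r\<close> balances the two factors of \<open>p ^ r = P * Q\<close>. The
  auxiliary function has weight below \<open>Q * (P + 3 * (d * p))\<close>: the main part
  \<open>p ^ r\<close> is the expected value of \<open>p * card A\<close>, and the excess is a
  multiple of \<open>Q\<close>, about the square root of \<open>p ^ r\<close>.\<close>

theorem stepanov_bound:
  assumes "A \<subseteq> subfld r - {0}" "\<And>x. x \<in> A \<Longrightarrow> \<exists>z\<in>subfld r. (x, z) \<in> curve"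
    and large: "p ^ (r div 2) \<ge> 2 * (d * p) + 4"
  shows "p * card A \<le> p ^ r + 3 * (d * p) * p ^ (r - r div 2)"
proof -
  define P Q c where "P = p ^ (r div 2)" and "Q = p ^ (r - r div 2)" and "c = d * p"
  have PQ: "P * Q = p ^ r" by (simp add: P_def Q_def flip: power_add)
  have "P \<le> Q" unfolding P_def Q_def using p_gt_1 by (intro power_increasing) auto
  have P: "P \<ge> 2 * c + 4" using large by (simp add: P_def c_def)
  \<comment> \<open>The two index sets then have at least \<open>P - c\<close> and
    \<open>P + 2 * c\<close> elements. The product of these numbers,
    \<open>P ^ 2 + c * P - 2 * c ^ 2\<close>, exceeds \<open>l * P + m + 1 = P ^ 2 + 3 * c\<close>
    once \<open>P > 2 * c + 3\<close>; this is the origin of \<open>large\<close>.\<close>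
  define l m where "l = P - 1" and "m = P + 3 * c - 1"
  have U: "card (weights \<inter> {..m}) \<ge> P + 2 * c"
  proof -
    have "c \<le> m" using P unfolding m_def by linarith
    then show ?thesis using weights_card[of m, folded c_def] P unfolding m_def by linarith
  qed
  have V: "card (weights \<inter> {..l}) \<ge> P - c"
    using weights_card[of l, folded c_def] P by (simp add: l_def)
  obtain k where k: "P = 2 * c + 4 + k" using P by (metis le_add_diff_inverse)
  have "c > 0" using d_pos p_gt_1 by (simp add: c_def)
  then have "l * P + m + 1 < (P - c) * (P + 2 * c)"
    unfolding l_def m_def k by (simp add: algebra_simps)
  also have "\<dots> \<le> card (weights \<inter> {..l}) * card (weights \<inter> {..m})"
    using U V by (intro mult_mono) auto
  finally have dim: "l * P + m + 1 < card (weights \<inter> {..l}) * card (weights \<inter> {..m})" .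
  have "l < Q" using \<open>P \<le> Q\<close> P by (simp add: l_def)
  obtain f w where f: "f \<in> exact w" "w \<le> l + Q * m"
    "\<And>x z. (x, z) \<in> curve \<Longrightarrow> x \<in> subfld r \<Longrightarrow> z \<in> subfld r \<Longrightarrow> f (x, z) = 0"
    using auxiliary_function_exists[OF P_def Q_def _ \<open>l < Q\<close> dim] by auto
  have "p * card A \<le> w"
    using combination_nonzero_imp_few_zeros[OF f(1) assms(1) assms(2) f(3)] by blast
  also have "\<dots> \<le> l + Q * m" by (rule f(2))
  also have "\<dots> \<le> Q + Q * m" using \<open>l < Q\<close> by simp
  also have "\<dots> = Q * (P + 3 * c)" using P by (simp add: m_def flip: mult_Suc_right)
  also have "\<dots> = p ^ r + 3 * c * Q" by (simp add: algebra_simps flip: PQ)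
  finally show ?thesis by (simp add: c_def Q_def)
qed

end

section \<open>One-variable sums over extension fields\<close>

definition laurent_eval :: "(int \<Rightarrow> 'a) \<Rightarrow> nat \<Rightarrow> 'a::field \<Rightarrow> 'a" where
  "laurent_eval a D x = (\<Sum>k\<in>{- int D..int D}. a k * x powi k)"

definition exp_sum :: "(int \<Rightarrow> 'a::field_prime_char) \<Rightarrow> nat \<Rightarrow> nat \<Rightarrow> complex" where
  "exp_sum a D r = (\<Sum>x\<in>subfld r - {0}. add_char (trace_to_prime r (laurent_eval a D x)))"

lemma laurent_eval_subfld:
  assumes "\<And>k. a k \<in> subfld 1" "x \<in> subfld r" shows "laurent_eval a D x \<in> subfld r"
  unfolding laurent_eval_def using assms(2) subfld_1_subset[OF assms(1)]
  by (intro subfld_sum subfld_mult subfld_powi)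

lemma frob_laurent_eval:
  assumes "\<And>k. a k \<in> subfld 1" shows "frob i (laurent_eval a D x) = laurent_eval a D (frob i x)"
  using subfldD[OF subfld_1_subset[OF assms], of i]
  by (simp add: laurent_eval_def frob_sum frob_mult frob_powi)

text \<open>The additive form of Hilbert 90. A solution exists in the closed field; each application
  of Frobenius adds one conjugate of \<open>c\<close> to it, so \<open>r\<close> applications add
  the trace, which is 0, and the solution is rational.\<close>

lemma artin_schreier_solvable:
  fixes c :: "'a::{alg_closed_field,field_prime_char}"
  assumes "c \<in> subfld r" "trace_to_prime r c = 0"
  shows "\<exists>y\<in>subfld r. y ^ CHAR('a) = y + c"
proof -
  define p where "p = CHAR('a)"
  have p: "p > 1" unfolding p_def by (rule CHAR_gt_1)
  define g where "g = monom 1 p + [:-c, -1:]"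
  have "degree [:-c, -1:] < p" using p by simp
  then have "degree g = p"
    unfolding g_def by (subst degree_add_eq_left) (auto simp: degree_monom_eq)
  with p obtain y where "poly g y = 0" using alg_closed_imp_poly_has_root[of g] by auto
  then have y: "frob 1 y = y + c" by (simp add: g_def poly_monom frob_def p_def algebra_simps)
  have "frob i y = y + (\<Sum>j<i. frob j c)" for i
  proof (induction i)
    case (Suc i)
    have "frob (Suc i) y = frob i (frob 1 y)" by (simp add: frob_frob)
    also have "\<dots> = frob i y + frob i c" by (simp only: y frob_add)
    finally show ?case using Suc by (simp add: add_ac)
  qed auto
  from this[of r] assms have "y \<in> subfld r" by (simp add: subfld_def trace_to_prime_def)
  moreover have "y ^ CHAR('a) = y + c" using y by (simp add: frob_def)
  ultimately show ?thesis by blast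
qed

text \<open>Once one point \<open>x0\<close> of the fibre is fixed, the difference of the values at
  \<open>x\<close> and \<open>x0\<close> has trace 0, so every \<open>x\<close> in the fibre lifts
  to a rational point of a single curve, with \<open>b\<close> the value at \<open>x0\<close>. The
  degree \<open>d\<close> is congruent to \<open>n\<close> modulo \<open>p\<close>, and
  \<open>0 < n \<le> D < p\<close> makes it prime to \<open>p\<close>.\<close>

lemma card_trace_fiber:
  fixes a :: "int \<Rightarrow> 'a::{alg_closed_field,field_prime_char}"
  assumes p: "p = CHAR('a)" and a: "\<And>k. a k \<in> subfld 1" and "r > 0"
    and D: "D < p" and n: "0 < n" "n \<le> D" "a (int n) \<noteq> 0" "\<And>k. k > int n \<Longrightarrow> a k = 0"
    and d: "d = n + D * p" and large: "p ^ (r div 2) \<ge> 2 * (d * p) + 4"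
  shows "p * card {x \<in> subfld r - {0}. trace_to_prime r (laurent_eval a D x) = t}
    \<le> p ^ r + 3 * (d * p) * p ^ (r - r div 2)"
proof (cases "{x \<in> subfld r - {0}. trace_to_prime r (laurent_eval a D x) = t} = {}")
  case False
  define A where "A = {x \<in> subfld r - {0}. trace_to_prime r (laurent_eval a D x) = t}"
  from False obtain x0 where x0: "x0 \<in> subfld r" "trace_to_prime r (laurent_eval a D x0) = t" by auto
  define b where "b = laurent_eval a D x0"
  have b: "b \<in> subfld r" unfolding b_def by (intro laurent_eval_subfld a x0)
  define a' where "a' k = a k - (if k = 0 then b else 0)" for k
  have a': "a' k \<in> subfld r" for k
    unfolding a'_def using subfld_1_subset[OF a[of k], of r] b by (auto intro!: subfld_diff)
  \<comment> \<open>A multiple of \<open>p\<close>, so that \<open>x ^ N\<close> is the p-th power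
    of \<open>x ^ D\<close> and the lift is \<open>z = x ^ D * y\<close>; the curve has
    \<open>e = D\<close>.\<close>
  define N where "N = D * p"
  define F where "F = (\<Sum>k\<in>{- int D..int D}. monom (a' k) (nat (k + int N)))"
  have p1: "p > 1" unfolding p by (rule CHAR_gt_1)
  have DN: "int D \<le> int N" unfolding N_def of_nat_le_iff using p1 by simp
  have dN: "d = n + N" by (simp add: d N_def)
  have poly_F: "poly F x = x ^ N * (laurent_eval a D x - b)" if "x \<noteq> 0" for x
  proof -
    have "poly F x = (\<Sum>k\<in>{- int D..int D}. x ^ N * (a' k * x powi k))"
      unfolding F_def poly_sum poly_monom
    proof (intro sum.cong refl)
      fix k assume "k \<in> {- int D..int D}"
      then have "k + int N \<ge> 0" using DN by simp
      then have "x ^ nat (k + int N) = x powi (k + int N)" by (simp add: power_int_def)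
      also have "\<dots> = x powi k * x ^ N" using that by (simp add: power_int_add)
      finally show "a' k * x ^ nat (k + int N) = x ^ N * (a' k * x powi k)" by simp
    qed
    also have "\<dots> = x ^ N * (\<Sum>k\<in>{- int D..int D}. a' k * x powi k)"
      by (simp add: sum_distrib_left)
    also have "(\<Sum>k\<in>{- int D..int D}. a' k * x powi k) =
        (\<Sum>k\<in>{- int D..int D}. a k * x powi k - (if k = 0 then b else 0))"
      by (intro sum.cong refl) (auto simp: a'_def)
    also have "\<dots> = laurent_eval a D x - b"
      by (simp add: sum_subtractf laurent_eval_def)
    finally show ?thesis .
  qed
  have coeff_F: "coeff F i \<in> subfld r" for i
    unfolding F_def coeff_sum by (intro subfld_sum) (auto simp: a')
  have "coeff F d = (\<Sum>k\<in>{- int D..int D}. if k = int n then a' k else 0)"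
    unfolding F_def coeff_sum
  proof (intro sum.cong refl)
    fix k assume "k \<in> {- int D..int D}"
    then have "nat (k + int N) = d \<longleftrightarrow> k = int n"
      using DN by (auto simp: dN)
    then show "coeff (monom (a' k) (nat (k + int N))) d = (if k = int n then a' k else 0)"
      by simp
  qed
  also have "\<dots> = a (int n)" using n by (simp add: a'_def)
  finally have "coeff F d \<noteq> 0" using n by simp
  moreover have "degree F \<le> d"
    unfolding F_def
  proof (rule degree_sum_le)
    fix k assume "k \<in> {- int D..int D}"
    show "degree (monom (a' k) (nat (k + int N))) \<le> d"
    proof (cases "k > int n")
      case True
      then show ?thesis using n(4)[OF True] by (simp add: a'_def)
    next
      case False
      then have "nat (k + int N) \<le> d" by (simp add: dN)
      then show ?thesis using degree_monom_le le_trans by blast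
    qed
  qed simp
  ultimately have deg: "d = degree F" by (meson le_antisym le_degree)
  interpret artin_schreier_curve F p d D r
  proof
    show "\<not> p dvd d" using n D by (auto simp: d dvd_add_left_iff dest: dvd_imp_le)
    show "p * D < d" using n by (simp add: d mult.commute)
  qed (use p deg \<open>r > 0\<close> coeff_F in auto)
  have "p * card A \<le> p ^ r + 3 * (d * p) * p ^ (r - r div 2)"
  proof (rule stepanov_bound)
    fix x assume x: "x \<in> A"
    then have "trace_to_prime r (laurent_eval a D x - b) = 0"
      using x0 by (simp add: trace_to_prime_diff A_def b_def)
    moreover have "laurent_eval a D x - b \<in> subfld r"
      using x b by (intro subfld_diff laurent_eval_subfld a) (auto simp: A_def)
    ultimately obtain y where y: "y \<in> subfld r" "y ^ p = y + (laurent_eval a D x - b)"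
      using artin_schreier_solvable[of _ r] unfolding p by blast
    have "N = D * (p - 1) + D" unfolding N_def using p1 by (cases p) auto
    then have xp: "x ^ N = x ^ (D * (p - 1)) * x ^ D" by (simp only: power_add)
    have "(x ^ D * y) ^ p = x ^ N * (y + (laurent_eval a D x - b))"
      by (simp add: power_mult_distrib y(2) N_def flip: power_mult)
    also have "\<dots> = x ^ N * y + poly F x"
      using x by (subst poly_F) (auto simp: A_def distrib_left)
    finally have "(x, x ^ D * y) \<in> curve" by (simp add: curve_def xp mult.assoc)
    moreover have "x ^ D * y \<in> subfld r" using x y by (intro subfld_mult subfld_power) (auto simp: A_def)
    ultimately show "\<exists>z\<in>subfld r. (x, z) \<in> curve" by blast
  qed (use large in \<open>auto simp: A_def\<close>)
  then show ?thesis by (simp add: A_def)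
next
  case True
  show ?thesis by (simp only: True card.empty mult_0_right zero_le)
qed

section \<open>From fibre sizes to exponential sums\<close>

lemma sum_add_char: "(\<Sum>t\<in>subfld 1. add_char (t :: 'a::{alg_closed_field,field_prime_char})) = 0"
proof -
  let ?S = "\<Sum>t\<in>subfld 1. add_char (t :: 'a)"
  have "?S = (\<Sum>t\<in>subfld 1. add_char (1 + t :: 'a))"
    by (rule sum.reindex_bij_witness[of _ "\<lambda>t. 1 + t" "\<lambda>t. t - 1"]) (auto intro!: subfld_add subfld_diff)
  also have "\<dots> = add_char (1 :: 'a) * ?S"
    by (simp add: add_char_add sum_distrib_left)
  finally have "(1 - add_char (1 :: 'a)) * ?S = 0" by (simp add: algebra_simps)
  with add_char_neq_1[of "1 :: 'a"] show ?thesis by simp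
qed

text \<open>
  Upper bounds for all the fibres suffice: as the character sums to zero, the fibre sizes may be
  replaced by their defects from the bound.
\<close>

lemma norm_exp_sum_le_of_fibers:
  fixes g :: "'b \<Rightarrow> 'a::{alg_closed_field,field_prime_char}"
  assumes "finite B" "g ` B \<subseteq> subfld 1"
    and "\<And>t. real CHAR('a) * real (card {x \<in> B. g x = t}) \<le> real (card B) + E"
  shows "cmod (\<Sum>x\<in>B. add_char (g x)) \<le> E"
proof -
  define M where "M = (real (card B) + E) / real CHAR('a)"
  have p: "CHAR('a) > 1" by (rule CHAR_gt_1)
  define N where "N t = card {x \<in> B. g x = t}" for t
  have N: "real (N t) \<le> M" for t
    using assms(3)[of t] p by (simp add: M_def N_def field_simps)
  have fin: "finite (subfld 1 :: 'a set)" by (simp add: finite_subfld)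
  have "(\<Sum>x\<in>B. add_char (g x)) = (\<Sum>t\<in>subfld 1. \<Sum>x | x \<in> B \<and> g x = t. add_char (g x))"
    using assms fin by (intro sum.group[symmetric]) auto
  also have "\<dots> = (\<Sum>t\<in>subfld 1. of_real (real (N t)) * add_char t)"
    by (intro sum.cong refl) (simp add: N_def)
  also have "\<dots> = (\<Sum>t\<in>subfld 1. of_real (real (N t) - M) * add_char t)"
    using sum_add_char[where ?'a = 'a] by (simp add: left_diff_distrib sum_subtractf flip: sum_distrib_left)
  finally have "cmod (\<Sum>x\<in>B. add_char (g x)) \<le> (\<Sum>t\<in>subfld 1. cmod (of_real (real (N t) - M) * add_char (t :: 'a)))"
    by (metis norm_sum)
  also have "\<dots> = (\<Sum>t\<in>(subfld 1 :: 'a set). M - real (N t))"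
    using N by (intro sum.cong refl) (simp add: norm_mult del: of_real_diff)
  also have "\<dots> = real CHAR('a) * M - real (\<Sum>t\<in>subfld 1. N t)"
    by (simp add: sum_subtractf card_subfld)
  also have "(\<Sum>t\<in>subfld 1. N t) = card B"
    using sum.group[OF assms(1) fin assms(2), of "\<lambda>_. 1 :: nat"] by (simp add: N_def)
  also have "real CHAR('a) * M - real (card B) = E" using p by (simp add: M_def)
  finally show ?thesis .
qed

text \<open>\<open>C\<close> and \<open>r0\<close> may depend on \<open>p\<close> and
  \<open>D\<close>: only the growth rate in \<open>r\<close> is passed on to the L-function.\<close>

lemma norm_exp_sum_large_r:
  fixes a :: "int \<Rightarrow> 'a::{alg_closed_field,field_prime_char}"
  assumes p: "p = CHAR('a)" and a: "\<And>k. a k \<in> subfld 1"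
    and D: "D < p" and n: "0 < n" "n \<le> D" "a (int n) \<noteq> 0" "\<And>k. k > int n \<Longrightarrow> a k = 0"
  shows "\<exists>C r0. \<forall>r\<ge>r0. cmod (exp_sum a D r) \<le> C * sqrt (real p) ^ r"
proof -
  define d where "d = n + D * p"
  have p1: "p > 1" unfolding p by (rule CHAR_gt_1)
  define C where "C = real (3 * (d * p) * p + 1)"
  \<comment> \<open>Chosen so that \<open>k < 2 ^ k\<close> with \<open>k = r div 2\<close> already
    gives the size condition of the point count.\<close>
  define r0 where "r0 = 2 * (2 * (d * p) + 4)"
  have "cmod (exp_sum a D r) \<le> C * sqrt (real p) ^ r" if r: "r \<ge> r0" for r
  proof -
    have r_pos: "r > 0" using r by (simp add: r0_def)
    let ?k = "r div 2"
    have "2 * (d * p) + 4 \<le> ?k" using r by (simp add: r0_def)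
    also have "?k < 2 ^ ?k" by (rule less_exp)
    also have "2 ^ ?k \<le> p ^ ?k" using p1 by (intro power_mono) auto
    finally have large: "p ^ ?k \<ge> 2 * (d * p) + 4" by simp
    define E where "E = 3 * (d * p) * p ^ (r - r div 2)"
    have fib: "p * card {x \<in> subfld r - {0}. trace_to_prime r (laurent_eval a D x) = t} \<le> p ^ r + E" for t
      unfolding E_def by (rule card_trace_fiber[where a = a, OF p a r_pos D n(1-3) _ d_def large]) (rule n(4))
    have card: "card (subfld r - {0 :: 'a}) = p ^ r - 1"
      using finite_subfld[OF r_pos, where ?'a = 'a] by (simp add: card_Diff_singleton card_subfld r_pos p)
    \<comment> \<open>The additional 1 compensates for the omitted point 0, since the sum has only
      \<open>p ^ r - 1\<close> terms.\<close>
    have "cmod (exp_sum a D r) \<le> real E + 1"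
      unfolding exp_sum_def
    proof (rule norm_exp_sum_le_of_fibers)
      fix t
      have "p ^ r \<ge> 1" using p1 by simp
      then have "p ^ r + E = card (subfld r - {0 :: 'a}) + (E + 1)" by (simp add: card)
      with fib[of t] have "p * card {x \<in> subfld r - {0}. trace_to_prime r (laurent_eval a D x) = t}
          \<le> card (subfld r - {0 :: 'a}) + (E + 1)" by simp
      then have "real (p * card {x \<in> subfld r - {0}. trace_to_prime r (laurent_eval a D x) = t})
          \<le> real (card (subfld r - {0 :: 'a}) + (E + 1))" by (simp only: of_nat_le_iff)
      then show "real CHAR('a) * real (card {x \<in> subfld r - {0}. trace_to_prime r (laurent_eval a D x) = t})
          \<le> real (card (subfld r - {0 :: 'a})) + (real E + 1)" by (simp add: p)
      show "(\<lambda>x. trace_to_prime r (laurent_eval a D x)) ` (subfld r - {0}) \<subseteq> subfld 1"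
        by (intro image_subsetI trace_in_prime laurent_eval_subfld a) auto
    qed (use finite_subfld[OF r_pos] in auto)
    also have "real E + 1 \<le> C * sqrt (real p) ^ r"
    proof -
      have s1: "sqrt (real p) \<ge> 1" using p1 by simp
      \<comment> \<open>For odd \<open>r\<close> the exponent is rounded up; one factor
        \<open>p\<close> absorbs this.\<close>
      have "real (p ^ (r - r div 2)) = sqrt (real p) ^ (2 * (r - r div 2))"
        by (simp add: power_mult)
      also have "\<dots> \<le> sqrt (real p) ^ (r + 2)" using s1 by (intro power_increasing) auto
      also have "\<dots> = real p * sqrt (real p) ^ r" by (simp add: power_add power2_eq_square)
      finally have "real E \<le> real (3 * (d * p)) * (real p * sqrt (real p) ^ r)"
        unfolding E_def of_nat_mult[of "3 * (d * p)"] by (intro mult_left_mono) auto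
      moreover have "1 \<le> sqrt (real p) ^ r" using s1 by simp
      ultimately show ?thesis by (simp add: C_def algebra_simps)
    qed
    finally show ?thesis .
  qed
  then show ?thesis by blast
qed

section \<open>The L-function\<close>

text \<open>
  Monic polynomials over the prime field with nonzero constant coefficient are encoded by the
  multisets of their roots, which are the Frobenius-stable multisets.
\<close>

definition divisors :: "nat \<Rightarrow> 'a::field_prime_char multiset set" where
  "divisors m = {R. size R = m \<and> 0 \<notin># R \<and> image_mset (frob 1) R = R}"

definition prime_polys :: "nat \<Rightarrow> 'a::field_prime_char poly set" where
  "prime_polys m = {g. degree g = m \<and> lead_coeff g = 1 \<and> coeff g 0 \<noteq> 0 \<and> (\<forall>i. coeff g i \<in> subfld 1)}"

definition root_poly :: "'a::comm_ring_1 multiset \<Rightarrow> 'a poly" where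
  "root_poly R = (\<Prod>x\<in>#R. [:-x, 1:])"

definition divisor_eval :: "(int \<Rightarrow> 'a::field) \<Rightarrow> nat \<Rightarrow> 'a multiset \<Rightarrow> 'a" where
  "divisor_eval a D R = (\<Sum>x\<in>#R. laurent_eval a D x)"

text \<open>The coefficient of T^m in the L-function. As \<open>divisor_eval\<close> is additive on
  multisets, the summand is multiplicative on divisors.\<close>

definition L_coeff :: "(int \<Rightarrow> 'a::field_prime_char) \<Rightarrow> nat \<Rightarrow> nat \<Rightarrow> complex" where
  "L_coeff a D m = (\<Sum>R\<in>divisors m. add_char (divisor_eval a D R))"

text \<open>If \<open>x\<close> already lies in a smaller field, its conjugates are repeated and the
  multiset is a multiple of a closed point. This matches S_r, which runs over all of
  \<open>subfld r\<close> and not only over generators.\<close>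

definition orbit :: "nat \<Rightarrow> 'a::field_prime_char \<Rightarrow> 'a multiset" where
  "orbit r x = image_mset (\<lambda>i. frob i x) (mset_set {..<r})"

lemma root_poly_empty [simp]: "root_poly {#} = 1"
  by (simp add: root_poly_def)

lemma root_poly_add: "root_poly (add_mset x R) = [:-x, 1:] * root_poly R"
  by (simp add: root_poly_def)

lemma root_poly_nonzero [simp]: "root_poly R \<noteq> (0 :: 'a::idom poly)"
  unfolding root_poly_def by (rule linear_factors_nonzero)

lemma proots_root_poly [simp]: "proots (root_poly R) = (R :: 'a::idom multiset)"
  unfolding root_poly_def by (rule proots_linear_factors)

lemma degree_lead_coeff_root_poly:
  "degree (root_poly R) = size R \<and> lead_coeff (root_poly R) = (1 :: 'a::idom)"
proof (induction R)
  case (add x R)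
  have "degree ([:-x, 1:] * root_poly R) = Suc (size R)"
    using add by (subst degree_mult_eq) auto
  moreover have "lead_coeff ([:-x, 1:] * root_poly R) = 1"
    unfolding lead_coeff_mult conjunct2[OF add] by simp
  ultimately show ?case by (simp only: root_poly_add size_add_mset)
qed auto

lemma coeff_0_root_poly: "coeff (root_poly R) 0 = (\<Prod>x\<in>#R. - x)"
  by (induction R) (auto simp: root_poly_add coeff_mult del: mult_pCons_left)

lemma coeff_0_root_poly_eq_0_iff: "coeff (root_poly R) 0 = (0 :: 'a::idom) \<longleftrightarrow> 0 \<in># R"
  by (auto simp: coeff_0_root_poly prod_mset_zero_iff)

lemma map_poly_frob_mult: "map_poly (frob i) (g * h) = map_poly (frob i) g * map_poly (frob i) h"
  by (rule poly_eqI) (simp add: coeff_map_poly coeff_mult frob_sum frob_mult)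

lemma map_poly_frob_root_poly: "map_poly (frob i) (root_poly R) = root_poly (image_mset (frob i) R)"
  by (induction R)
     (simp_all add: root_poly_add map_poly_frob_mult map_poly_pCons frob_uminus del: mult_pCons_left)

text \<open>Frobenius fixes the coefficients of a monic polynomial exactly if it permutes the roots
  with their multiplicities. Multisets suit the multiplicative structure of L; polynomials make
  finiteness visible and allow a single coefficient to be changed.\<close>

lemma bij_betw_root_poly:
  "bij_betw root_poly (divisors m) (prime_polys m :: 'a::{alg_closed_field,field_prime_char} poly set)"
proof (rule bij_betwI')
  fix R S :: "'a multiset"
  show "root_poly R = root_poly S \<longleftrightarrow> R = S" by (metis proots_root_poly)
next
  fix R :: "'a multiset" assume R: "R \<in> divisors m"
  then have "map_poly (frob 1) (root_poly R) = root_poly R"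
    by (simp add: map_poly_frob_root_poly divisors_def)
  then have "frob 1 (coeff (root_poly R) i) = coeff (root_poly R) i" for i
    by (metis coeff_map_poly frob_zero)
  then show "root_poly R \<in> prime_polys m"
    using R degree_lead_coeff_root_poly[of R]
    by (auto simp: prime_polys_def divisors_def subfld_def coeff_0_root_poly_eq_0_iff)
next
  fix g :: "'a poly" assume g: "g \<in> prime_polys m"
  then have "g \<noteq> 0" by (auto simp: prime_polys_def)
  then obtain R where R: "size R = degree g" "g = smult (lead_coeff g) (root_poly R)"
    unfolding root_poly_def using alg_closed_imp_factorization by blast
  have "lead_coeff g = 1" using g unfolding prime_polys_def by blast
  then have gR: "g = root_poly R" by (subst R(2)) simp
  have "map_poly (frob 1) g = g"
    using g by (intro poly_eqI) (auto simp: coeff_map_poly prime_polys_def subfld_def)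
  then have "root_poly (image_mset (frob 1) R) = root_poly R"
    unfolding gR by (simp add: map_poly_frob_root_poly)
  then have "image_mset (frob 1) R = R" by (metis proots_root_poly)
  moreover have "0 \<notin># R" using g coeff_0_root_poly_eq_0_iff[of R] by (auto simp: gR prime_polys_def)
  ultimately have "R \<in> divisors m" using R(1) g by (simp add: divisors_def prime_polys_def)
  with gR show "\<exists>R\<in>divisors m. g = root_poly R" by blast
qed

lemma finite_prime_polys: "finite (prime_polys m :: 'a::{alg_closed_field,field_prime_char} poly set)"
proof -
  have "(prime_polys m :: 'a poly set) \<subseteq> Poly ` {xs. set xs \<subseteq> subfld 1 \<and> length xs \<le> m + 1}"
  proof
    fix g :: "'a poly" assume g: "g \<in> prime_polys m"
    have "set (coeffs g) \<subseteq> subfld 1" using g by (auto simp: coeffs_def prime_polys_def)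
    moreover have "length (coeffs g) \<le> m + 1" using g by (auto simp: coeffs_def prime_polys_def)
    ultimately show "g \<in> Poly ` {xs. set xs \<subseteq> subfld 1 \<and> length xs \<le> m + 1}"
      by (intro image_eqI[of _ _ "coeffs g"]) auto
  qed
  then show ?thesis
    by (rule finite_subset) (intro finite_imageI finite_lists_length_le finite_subfld, simp)
qed

lemma finite_divisors: "finite (divisors m :: 'a::{alg_closed_field,field_prime_char} multiset set)"
  using bij_betw_finite[OF bij_betw_root_poly] finite_prime_polys by blast

lemma divisor_eval_add: "divisor_eval a D (R + S) = divisor_eval a D R + divisor_eval a D S"
  by (simp add: divisor_eval_def)

lemma divisor_eval_in_prime:
  assumes "\<And>k. a k \<in> subfld 1" "R \<in> divisors m" shows "divisor_eval a D R \<in> subfld 1"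
proof -
  have "frob 1 (divisor_eval a D R) = divisor_eval a D (image_mset (frob 1) R)"
    by (simp add: divisor_eval_def frob_sum_mset frob_laurent_eval[of a, OF assms(1)]
        image_mset.compositionality o_def)
  also have "\<dots> = divisor_eval a D R" using assms(2) by (simp add: divisors_def)
  finally show ?thesis by (simp add: subfld_def)
qed

section \<open>Orbits inside divisors and the recurrence for the coefficients of L\<close>

lemma size_orbit [simp]: "size (orbit r x) = r"
  by (simp add: orbit_def)

lemma orbit_add: "orbit (m + n) x = orbit m x + orbit n (frob m x)"
proof (induction n)
  case (Suc n)
  then show ?case by (simp add: orbit_def lessThan_Suc frob_frob add.commute)
qed (simp add: orbit_def)

lemma orbit_in_divisors:
  assumes "x \<in> subfld r" "x \<noteq> 0" shows "orbit r x \<in> divisors r"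
proof -
  have "orbit 1 x + orbit r (frob 1 x) = orbit r x + orbit 1 (frob r x)"
    by (simp add: add.commute flip: orbit_add)
  then have "orbit r (frob 1 x) = orbit r x" using assms by (simp add: subfldD)
  moreover have "image_mset (frob 1) (orbit r x) = orbit r (frob 1 x)"
    by (simp add: orbit_def image_mset.compositionality o_def frob_frob)
  ultimately show ?thesis using assms by (auto simp: divisors_def orbit_def)
qed

lemma divisor_eval_orbit:
  assumes "\<And>k. a k \<in> subfld 1"
  shows "divisor_eval a D (orbit r x) = trace_to_prime r (laurent_eval a D x)"
  by (simp add: divisor_eval_def orbit_def trace_to_prime_def image_mset.compositionality o_def
      frob_laurent_eval[of a, OF assms] sum_unfold_sum_mset)

lemma divisors_diff:
  assumes "R \<in> divisors m" "S \<in> divisors n" "S \<subseteq># R" shows "R - S \<in> divisors (m - n)"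
  using assms by (auto simp: divisors_def size_Diff_submset image_mset_Diff dest: in_diffD)

lemma divisors_add:
  assumes "R \<in> divisors m" "S \<in> divisors n" shows "R + S \<in> divisors (m + n)"
  using assms by (auto simp: divisors_def)

lemma count_image_mset_of_inj: "inj f \<Longrightarrow> count (image_mset f R) (f x) = count R x"
  by (induction R) (auto dest: injD)

text \<open>Let \<open>d\<close> be the least period of \<open>x\<close> under Frobenius. The
  admissible \<open>r\<close> are the multiples \<open>j * d\<close>, and
  \<open>orbit (j * d) x\<close> is \<open>j\<close> copies of the set of conjugates. All conjugates
  have the same multiplicity in the stable multiset \<open>R\<close>, so these copies fit exactly
  for \<open>j \<le> count R x\<close>.\<close>

lemma card_orbit_subsets:
  fixes x :: "'a::field_prime_char"
  assumes R: "R \<in> divisors m"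
  shows "card {r \<in> {1..m}. x \<in> subfld r \<and> orbit r x \<subseteq># R} = count R x"
proof (cases "x \<in># R")
  case False
  have "x \<in># orbit r x" if "r \<ge> 1" for r
    unfolding orbit_def using that by (auto intro!: image_eqI[of _ _ 0])
  with False have "{r \<in> {1..m}. x \<in> subfld r \<and> orbit r x \<subseteq># R} = {}"
    by (auto dest: mset_subset_eqD)
  with False show ?thesis by (simp add: not_in_iff)
next
  case True
  have count_frob: "count R (frob i x) = count R x" for i
  proof (induction i)
    case (Suc i)
    have "count R (frob (Suc i) x) = count (image_mset (frob 1) R) (frob 1 (frob i x))"
      using R by (simp add: divisors_def frob_frob)
    also have "\<dots> = count R (frob i x)" by (rule count_image_mset_of_inj) (rule inj_frob)
    finally show ?case using Suc by simp
  qed auto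
  \<comment> \<open>All conjugates lie in the finite multiset \<open>R\<close>, so \<open>x\<close>
    is periodic under Frobenius.\<close>
  have "range (\<lambda>i. frob i x) \<subseteq> set_mset R"
    using True count_frob by (auto simp flip: count_greater_zero_iff)
  then have "finite (range (\<lambda>i. frob i x))" by (rule finite_subset) simp
  then have "\<not> inj (\<lambda>i. frob i x)" using finite_imageD by blast
  then obtain i j where "i < j" "frob i x = frob j x" by (metis injI linorder_neq_iff)
  then have "frob i (frob (j - i) x) = frob i x" by (simp add: frob_frob)
  then have ex: "j - i > 0 \<and> frob (j - i) x = x" using \<open>i < j\<close> by (simp add: frob_inj)
  define d where "d = (LEAST d. d > 0 \<and> frob d x = x)"
  have d: "d > 0" "frob d x = x" using LeastI[of "\<lambda>d. d > 0 \<and> frob d x = x", OF ex] by (simp_all add: d_def)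
  have least: "frob e x \<noteq> x" if "0 < e" "e < d" for e
    using that not_less_Least[of e "\<lambda>d. d > 0 \<and> frob d x = x"] by (auto simp: d_def)
  have mult: "frob (j * d) x = x" for j
    by (induction j) (auto simp: d simp flip: frob_frob)
  have dvd: "x \<in> subfld r \<longleftrightarrow> d dvd r" for r
  proof
    assume "x \<in> subfld r"
    have "frob r x = frob (r mod d) (frob (r div d * d) x)" by (simp add: frob_frob mod_mult_div_eq)
    with \<open>x \<in> subfld r\<close> have "frob (r mod d) x = x" by (simp add: mult subfldD)
    then have "r mod d = 0" using least[of "r mod d"] d by (metis mod_less_divisor neq0_conv)
    then show "d dvd r" by auto
  next
    assume "d dvd r"
    then show "x \<in> subfld r" using mult by (auto simp: subfld_def mult.commute)
  qed
  have inj: "inj_on (\<lambda>i. frob i x) {..<d}"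
  proof (rule linorder_inj_onI)
    fix i j assume "i < j" "i \<in> {..<d}" "j \<in> {..<d}"
    show "frob i x \<noteq> frob j x"
    proof
      assume "frob i x = frob j x"
      then have "frob i (frob (j - i) x) = frob i x" using \<open>i < j\<close> by (simp add: frob_frob)
      then have "frob (j - i) x = x" by (simp add: frob_inj)
      with least[of "j - i"] \<open>i < j\<close> \<open>j \<in> {..<d}\<close> show False
        by (simp add: less_imp_diff_less)
    qed
  qed (simp add: nat_le_linear)
  define orb where "orb = (\<lambda>i. frob i x) ` {..<d}"
  have orbit_d: "orbit d x = mset_set orb"
    unfolding orbit_def orb_def by (rule image_mset_mset_set[OF inj])
  have count_orbit: "count (orbit (j * d) x) y = (if y \<in> orb then j else 0)" for j y
  proof (induction j)
    case (Suc j)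
    have "orbit (Suc j * d) x = orbit d x + orbit (j * d) x"
      by (simp add: orbit_add d)
    then show ?case using Suc by (simp add: orbit_d orb_def)
  qed (simp add: orbit_def)
  have sub: "orbit (j * d) x \<subseteq># R \<longleftrightarrow> j \<le> count R x" for j
  proof
    assume "orbit (j * d) x \<subseteq># R"
    then have "count (orbit (j * d) x) x \<le> count R x" by (rule mset_subset_eq_count)
    moreover have "x \<in> orb" unfolding orb_def using d by (auto intro!: image_eqI[of _ _ 0])
    ultimately show "j \<le> count R x" by (simp add: count_orbit)
  next
    assume "j \<le> count R x"
    then show "orbit (j * d) x \<subseteq># R"
      by (intro mset_subset_eqI) (auto simp: count_orbit orb_def count_frob)
  qed
  have "{r \<in> {1..m}. x \<in> subfld r \<and> orbit r x \<subseteq># R} = (\<lambda>j. j * d) ` {1..count R x}"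
  proof (intro equalityI subsetI)
    fix r assume r: "r \<in> {r \<in> {1..m}. x \<in> subfld r \<and> orbit r x \<subseteq># R}"
    then obtain j where "r = j * d" using dvd by (auto simp: mult.commute)
    with r sub show "r \<in> (\<lambda>j. j * d) ` {1..count R x}" by (auto simp: Suc_le_eq)
  next
    fix r assume "r \<in> (\<lambda>j. j * d) ` {1..count R x}"
    then obtain j where "r = j * d" "j \<in> {1..count R x}" by blast
    then have j: "r = j * d" "j \<ge> 1" "j \<le> count R x" by auto
    then have "orbit r x \<subseteq># R" using sub by simp
    moreover from this have "r \<le> m" using R size_mset_mono by (fastforce simp: divisors_def)
    ultimately show "r \<in> {r \<in> {1..m}. x \<in> subfld r \<and> orbit r x \<subseteq># R}"
      using j d dvd by (auto simp: Suc_le_eq)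
  qed
  also have "card \<dots> = count R x" using d by (subst card_image) (auto simp: inj_on_def)
  finally show ?thesis .
qed

text \<open>
  Counting the pairs (divisor, orbit contained in it) in two ways; this is \<open>T L'(T) = L(T) \<Sum>S\<^sub>r T\<^sup>r\<close>.
\<close>

lemma L_coeff_recurrence:
  fixes a :: "int \<Rightarrow> 'a::{alg_closed_field,field_prime_char}"
  assumes a: "\<And>k. a k \<in> subfld 1"
  shows "of_nat m * L_coeff a D m = (\<Sum>r=1..m. L_coeff a D (m - r) * exp_sum a D r)"
proof -
  define Z where "Z = (SIGMA r:{1..m}. subfld r - {0 :: 'a})"
  have Z: "finite Z" unfolding Z_def by (intro finite_SigmaI) (auto intro!: finite_subfld)
  let ?\<psi> = "\<lambda>R. add_char (divisor_eval a D R)"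
  \<comment> \<open>A divisor of degree \<open>m\<close> contains exactly \<open>m\<close> orbits:
    each element \<open>x\<close> accounts for as many of them as its multiplicity.\<close>
  have size: "(\<Sum>(r, x)\<in>Z. if orbit r x \<subseteq># R then 1 else 0) = m" if R: "R \<in> divisors m" for R
  proof -
    have "(\<Sum>(r, x)\<in>Z. if orbit r x \<subseteq># R then 1 else 0) = card {z \<in> Z. orbit (fst z) (snd z) \<subseteq># R}"
      using Z by (simp add: case_prod_unfold sum.If_cases Int_def)
    also have "{z \<in> Z. orbit (fst z) (snd z) \<subseteq># R} =
       (\<lambda>(x, r). (r, x)) ` (SIGMA x:set_mset R. {r \<in> {1..m}. x \<in> subfld r \<and> orbit r x \<subseteq># R})"
    proof (intro equalityI subsetI)
      fix z assume "z \<in> {z \<in> Z. orbit (fst z) (snd z) \<subseteq># R}"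
      then obtain r x where z: "z = (r, x)" "r \<in> {1..m}" "x \<in> subfld r" "orbit r x \<subseteq># R"
        by (auto simp: Z_def)
      have "x \<in># orbit r x" unfolding orbit_def using z(2) by (auto intro!: image_eqI[of _ _ 0])
      with z show "z \<in> (\<lambda>(x, r). (r, x)) ` (SIGMA x:set_mset R. {r \<in> {1..m}. x \<in> subfld r \<and> orbit r x \<subseteq># R})"
        by (auto intro!: image_eqI[of _ _ "(x, r)"] dest: mset_subset_eqD)
    qed (use R in \<open>auto simp: Z_def divisors_def\<close>)
    also have "card \<dots> = card (SIGMA x:set_mset R. {r \<in> {1..m}. x \<in> subfld r \<and> orbit r x \<subseteq># R})"
      by (intro card_image) (auto simp: inj_on_def)
    also have "\<dots> = (\<Sum>x\<in>set_mset R. count R x)"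
      by (subst card_SigmaI) (auto simp: card_orbit_subsets[OF R, simplified])
    also have "\<dots> = m" using R by (simp add: divisors_def size_multiset_overloaded_eq)
    finally show ?thesis .
  qed
  have "of_nat m * L_coeff a D m = (\<Sum>R\<in>divisors m. of_nat m * ?\<psi> R)"
    by (simp add: L_coeff_def sum_distrib_left)
  also have "\<dots> = (\<Sum>R\<in>divisors m. \<Sum>(r, x)\<in>Z. if orbit r x \<subseteq># R then ?\<psi> R else 0)"
  proof (intro sum.cong refl)
    fix R :: "'a multiset" assume R: "R \<in> divisors m"
    have "of_nat m * ?\<psi> R = (\<Sum>(r, x)\<in>Z. of_nat (if orbit r x \<subseteq># R then 1 else 0)) * ?\<psi> R"
      by (subst size[OF R, symmetric]) (simp add: case_prod_unfold)
    then show "of_nat m * ?\<psi> R = (\<Sum>(r, x)\<in>Z. if orbit r x \<subseteq># R then ?\<psi> R else 0)"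
      by (simp add: sum_distrib_right case_prod_unfold if_distrib[of "\<lambda>u. u * _"] if_distrib[of of_nat] cong: if_cong)
  qed
  also have "\<dots> = (\<Sum>(r, x)\<in>Z. \<Sum>R\<in>divisors m. if orbit r x \<subseteq># R then ?\<psi> R else 0)"
    unfolding case_prod_unfold by (rule sum.swap)
  also have "\<dots> = (\<Sum>(r, x)\<in>Z. L_coeff a D (m - r) * add_char (trace_to_prime r (laurent_eval a D x)))"
  proof (intro sum.cong refl, clarify)
    fix r and x :: 'a assume rx: "(r, x) \<in> Z"
    then have r: "r \<in> {1..m}" and x: "x \<in> subfld r" "x \<noteq> 0" by (auto simp: Z_def)
    note orb = orbit_in_divisors[OF x]
    have "(\<Sum>R\<in>divisors m. if orbit r x \<subseteq># R then ?\<psi> R else 0) = (\<Sum>R | R \<in> divisors m \<and> orbit r x \<subseteq># R. ?\<psi> R)"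
      by (simp add: sum.If_cases finite_divisors Int_def)
    \<comment> \<open>Removing the orbit leaves an arbitrary divisor of degree
      \<open>m - r\<close>.\<close>
    also have "\<dots> = (\<Sum>R\<in>divisors (m - r). ?\<psi> (R + orbit r x))"
    proof (rule sum.reindex_bij_witness[of _ "\<lambda>R. R + orbit r x" "\<lambda>R. R - orbit r x"])
      fix R :: "'a multiset" assume "R \<in> divisors (m - r)"
      from divisors_add[OF this orb] r show "R + orbit r x \<in> {R \<in> divisors m. orbit r x \<subseteq># R}" by simp
    qed (use divisors_diff[OF _ orb] in auto)
    also have "\<dots> = (\<Sum>R\<in>divisors (m - r). ?\<psi> R * ?\<psi> (orbit r x))"
      by (intro sum.cong refl) (use divisor_eval_in_prime[of a, OF a] orb in \<open>auto simp: divisor_eval_add add_char_add\<close>)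
    finally show "(\<Sum>R\<in>divisors m. if orbit r x \<subseteq># R then ?\<psi> R else 0) =
        L_coeff a D (m - r) * add_char (trace_to_prime r (laurent_eval a D x))"
      by (simp add: L_coeff_def sum_distrib_right divisor_eval_orbit[of a, OF a])
  qed
  also have "\<dots> = (\<Sum>r=1..m. \<Sum>x\<in>subfld r - {0}. L_coeff a D (m - r) * add_char (trace_to_prime r (laurent_eval a D x)))"
    unfolding Z_def by (intro sum.Sigma[symmetric]) (auto intro!: finite_subfld)
  finally show ?thesis by (simp add: exp_sum_def sum_distrib_left)
qed

lemma L_coeff_0 [simp]: "L_coeff (a :: int \<Rightarrow> 'a::field_prime_char) D 0 = 1"
proof -
  have "(divisors 0 :: 'a multiset set) = {{#}}" by (auto simp: divisors_def)
  then show ?thesis by (simp add: L_coeff_def divisor_eval_def)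
qed

text \<open>
  Newton's identities, as the logarithmic derivative of \<open>\<Prod>(1 - x T)\<close>, show how the power sums
  of the roots react to a change of one coefficient.
\<close>

definition root_fps :: "'a::field multiset \<Rightarrow> 'a fps" where
  "root_fps R = (\<Prod>x\<in>#R. 1 - fps_const x * fps_X)"

definition power_sum :: "nat \<Rightarrow> 'a::field multiset \<Rightarrow> 'a" where
  "power_sum k R = (\<Sum>x\<in>#R. x ^ k)"

definition power_sum_fps :: "'a::field multiset \<Rightarrow> 'a fps" where
  "power_sum_fps R = Abs_fps (\<lambda>k. if k = 0 then 0 else power_sum k R)"

lemma root_fps_log_deriv: "fps_X * fps_deriv (root_fps R) = - (root_fps R * power_sum_fps R)"
proof (induction R)
  case empty
  have "power_sum_fps {#} = (0 :: 'a fps)"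
    by (simp add: power_sum_fps_def power_sum_def fps_eq_iff)
  then show ?case by (simp add: root_fps_def)
next
  case (add x R)
  \<comment> \<open>The geometric series xT / (1 - xT), the contribution of one root to the power
    sums.\<close>
  define G where "G = Abs_fps (\<lambda>k. if k = 0 then 0 else x ^ k)"
  have G: "(1 - fps_const x * fps_X) * G = fps_const x * fps_X"
  proof (rule fps_ext)
    fix n
    show "((1 - fps_const x * fps_X) * G) $ n = (fps_const x * fps_X) $ n"
      by (cases n) (auto simp: G_def left_diff_distrib mult.assoc power_eq_if)
  qed
  have P: "power_sum_fps (add_mset x R) = G + power_sum_fps R"
    by (simp add: power_sum_fps_def power_sum_def G_def fps_eq_iff)
  have U: "root_fps (add_mset x R) = (1 - fps_const x * fps_X) * root_fps R"
    by (simp add: root_fps_def)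
  have "fps_X * fps_deriv (root_fps (add_mset x R)) =
      (1 - fps_const x * fps_X) * (fps_X * fps_deriv (root_fps R)) - (fps_const x * fps_X) * root_fps R"
    by (simp add: U algebra_simps)
  also have "\<dots> = - ((1 - fps_const x * fps_X) * root_fps R * power_sum_fps R) - (1 - fps_const x * fps_X) * G * root_fps R"
    unfolding add.IH G by (simp add: mult.assoc)
  also have "\<dots> = - (root_fps (add_mset x R) * power_sum_fps (add_mset x R))"
    by (simp add: U P algebra_simps)
  finally show ?case .
qed

lemma root_fps_nth_0 [simp]: "root_fps R $ 0 = 1"
  by (induction R) (auto simp: root_fps_def)

text \<open>Subtracting the two logarithmic derivatives gives \<open>root_fps B * E\<close> as a
  multiple of \<open>fps_X ^ s\<close>, where \<open>E\<close> is the difference of the power sum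
  series. \<open>root_fps B\<close> has constant term 1, so \<open>E\<close> vanishes below
  \<open>s\<close>; at \<open>s\<close> only \<open>- of_nat s * \<delta>\<close> remains because
  \<open>power_sum_fps A\<close> has no constant term.\<close>

lemma power_sum_perturb:
  fixes A B :: "'a::field multiset"
  assumes eq: "root_fps B = root_fps A + fps_const \<delta> * fps_X ^ s" and "s > 0"
  shows "0 < k \<Longrightarrow> k < s \<Longrightarrow> power_sum k B = power_sum k A"
    and "power_sum s B = power_sum s A - of_nat s * \<delta>"
proof -
  define E where "E = power_sum_fps B - power_sum_fps A"
  have X_deriv: "(fps_X * fps_deriv f) $ k = of_nat k * f $ k" for f :: "'a fps" and k
    by (cases k) simp_all
  have "fps_X * fps_deriv (root_fps B) = fps_X * fps_deriv (root_fps A) + fps_const (of_nat s * \<delta>) * fps_X ^ s"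
    by (rule fps_ext) (auto simp: X_deriv eq fps_X_power_nth distrib_left)
  then have deriv: "- (root_fps B * power_sum_fps B) = - (root_fps A * power_sum_fps A) + fps_const (of_nat s * \<delta>) * fps_X ^ s"
    by (simp only: root_fps_log_deriv)
  have "root_fps B * E = - (- (root_fps B * power_sum_fps B)) - root_fps B * power_sum_fps A"
    by (simp only: E_def right_diff_distrib minus_minus)
  also have "\<dots> = - (fps_const (of_nat s * \<delta>) * fps_X ^ s) - fps_const \<delta> * (fps_X ^ s * power_sum_fps A)"
    unfolding deriv by (simp add: eq distrib_right mult.assoc)
  finally have *: "root_fps B * E = - (fps_const (of_nat s * \<delta>) * fps_X ^ s) - fps_const \<delta> * (fps_X ^ s * power_sum_fps A)" .
  have rhs: "(root_fps B * E) $ k = (if k = s then - (of_nat s * \<delta>) else 0)" if "k \<le> s" for k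
    unfolding * using that
    by (auto simp: fps_X_power_mult_nth power_sum_fps_def)
  have lhs: "(root_fps B * E) $ k = E $ k" if "\<And>j. j < k \<Longrightarrow> E $ j = 0" for k
  proof -
    have "(root_fps B * E) $ k = (\<Sum>i=0..k. root_fps B $ i * E $ (k - i))" by (simp add: fps_mult_nth)
    also have "\<dots> = (\<Sum>i\<in>{0}. root_fps B $ i * E $ (k - i))"
      using that by (intro sum.mono_neutral_right) auto
    finally show ?thesis by simp
  qed
  have zero: "E $ k = 0" if "k < s" for k
    using that
  proof (induction k rule: less_induct)
    case (less k)
    then show ?case using lhs[of k] rhs[of k] by simp
  qed
  show "power_sum k B = power_sum k A" if "0 < k" "k < s"
    using zero[OF that(2)] that by (simp add: E_def power_sum_fps_def)
  have "E $ s = - (of_nat s * \<delta>)" using lhs[of s, OF zero] rhs[of s] by simp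
  then show "power_sum s B = power_sum s A - of_nat s * \<delta>"
    using \<open>s > 0\<close> by (simp add: E_def power_sum_fps_def algebra_simps)
qed

section \<open>Effect of one coefficient on the value at a divisor\<close>

lemma fps_of_poly_reflect_root_poly:
  assumes "0 \<notin># R" shows "fps_of_poly (reflect_poly (root_poly R)) = root_fps R"
  using assms
proof (induction R)
  case (add x R)
  have "reflect_poly [:-x, 1:] = [:1, -x:]"
    using add by (simp add: reflect_poly_def)
  then have "fps_of_poly (reflect_poly [:-x, 1:]) = 1 - fps_const x * fps_X"
    by (simp add: fps_of_poly_pCons fps_const_neg)
  then show ?case
    using add by (simp add: root_poly_add reflect_poly_mult fps_of_poly_mult root_fps_def del: mult_pCons_left)
qed (auto simp: root_fps_def)

text \<open>The coefficients counted from the top govern the power sums of the roots; those counted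
  from the bottom govern, by this identity, the power sums of their inverses.\<close>

lemma fps_of_poly_root_poly:
  assumes "0 \<notin># R"
  shows "fps_of_poly (root_poly R) = fps_const (coeff (root_poly R) 0) * root_fps (image_mset inverse R)"
  using assms
proof (induction R)
  case (add x R)
  have "fps_of_poly [:-x, 1:] = fps_const (- x) * (1 - fps_const (inverse x) * fps_X)"
    using add by (simp add: fps_of_poly_pCons right_diff_distrib flip: mult.assoc)
  then have "fps_of_poly (root_poly (add_mset x R)) = (fps_const (- x) * (1 - fps_const (inverse x) * fps_X)) *
      (fps_const (coeff (root_poly R) 0) * root_fps (image_mset inverse R))"
    using add by (simp add: root_poly_add fps_of_poly_mult del: mult_pCons_left)
  also have "\<dots> = (fps_const (- x) * fps_const (coeff (root_poly R) 0)) *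
      ((1 - fps_const (inverse x) * fps_X) * root_fps (image_mset inverse R))"
    by (simp only: mult_ac)
  finally show ?case by (simp add: coeff_0_root_poly root_fps_def)
qed (auto simp: root_fps_def)

lemma divisor_eval_power_sums:
  "divisor_eval a D R = of_nat (size R) * a 0 +
    (\<Sum>k=1..D. a (int k) * power_sum k R) + (\<Sum>k=1..D. a (- int k) * power_sum k (image_mset inverse R))"
proof (induction R)
  case (add x R)
  have "{- int D..int D} = insert 0 (int ` {1..D} \<union> (\<lambda>k. - int k) ` {1..D})"
  proof (intro equalityI subsetI)
    fix k assume "k \<in> {- int D..int D}"
    then show "k \<in> insert 0 (int ` {1..D} \<union> (\<lambda>k. - int k) ` {1..D})"
      by (cases k rule: int_cases2) (auto simp: image_iff)
  qed auto
  then have "laurent_eval a D x = (\<Sum>k\<in>insert 0 (int ` {1..D} \<union> (\<lambda>k. - int k) ` {1..D}). a k * x powi k)"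
    by (simp only: laurent_eval_def)
  also have "\<dots> = a 0 + ((\<Sum>k\<in>int ` {1..D}. a k * x powi k) + (\<Sum>k\<in>(\<lambda>k. - int k) ` {1..D}. a k * x powi k))"
    by (subst sum.insert) (auto intro!: sum.union_disjoint)
  also have "(\<Sum>k\<in>int ` {1..D}. a k * x powi k) = (\<Sum>k=1..D. a (int k) * x ^ k)"
    by (subst sum.reindex) (auto simp: inj_on_def)
  also have "(\<Sum>k\<in>(\<lambda>k. - int k) ` {1..D}. a k * x powi k) = (\<Sum>k=1..D. a (- int k) * inverse x ^ k)"
    by (subst sum.reindex) (auto simp: inj_on_def power_int_minus power_inverse)
  finally show ?case
    using add by (simp add: divisor_eval_def power_sum_def distrib_left distrib_right sum.distrib)
qed (simp add: divisor_eval_def power_sum_def)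

text \<open>The changed coefficient is the n-th from the top. Positive power sums below
  \<open>n\<close> stay the same, the n-th changes by \<open>- n\<close>, and higher ones have
  coefficient 0 in \<open>a\<close>. From the bottom it has index \<open>m - n\<close>, which
  exceeds \<open>D\<close>, so the power sums of the inverses that occur are unaffected.\<close>

lemma divisor_eval_perturb:
  fixes R S :: "'a::field multiset"
  assumes n: "0 < n" "\<And>k. k > int n \<Longrightarrow> a k = 0" "n \<le> D" "n + D < m"
    and R: "size R = m" "0 \<notin># R" and S: "size S = m" "0 \<notin># S"
    and eq: "root_poly S = root_poly R + monom 1 (m - n)"
  shows "divisor_eval a D S = divisor_eval a D R - of_nat n * a (int n)"
proof -
  have deg: "degree (root_poly R) = m" "degree (root_poly S) = m"
    using R S degree_lead_coeff_root_poly[of R] degree_lead_coeff_root_poly[of S] by simp_all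
  have "root_fps S = root_fps R + fps_const 1 * fps_X ^ n"
  proof (rule fps_ext)
    fix i
    show "root_fps S $ i = (root_fps R + fps_const 1 * fps_X ^ n) $ i"
      using n deg unfolding fps_of_poly_reflect_root_poly[OF R(2), symmetric] fps_of_poly_reflect_root_poly[OF S(2), symmetric]
      by (auto simp: coeff_reflect_poly eq[THEN arg_cong[where f = "\<lambda>g. coeff g _"]] fps_X_power_nth)
  qed
  note pos = power_sum_perturb[OF this n(1)]
  define c where "c = coeff (root_poly R) 0"
  have c: "c \<noteq> 0" "coeff (root_poly S) 0 = c"
    using R(2) n coeff_0_root_poly_eq_0_iff[of R] by (auto simp: c_def eq)
  have "fps_const c * root_fps (image_mset inverse S) = fps_of_poly (root_poly S)"
    using fps_of_poly_root_poly[OF S(2)] c by simp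
  also have "\<dots> = fps_const c * root_fps (image_mset inverse R) + fps_X ^ (m - n)"
    using fps_of_poly_root_poly[OF R(2)] by (simp add: eq fps_of_poly_add fps_of_poly_monom c_def)
  finally have "fps_const (inverse c) * (fps_const c * root_fps (image_mset inverse S)) =
     fps_const (inverse c) * (fps_const c * root_fps (image_mset inverse R) + fps_X ^ (m - n))" by simp
  then have "root_fps (image_mset inverse S) = root_fps (image_mset inverse R) + fps_const (inverse c) * fps_X ^ (m - n)"
    using c by (simp add: distrib_left flip: mult.assoc)
  note neg = power_sum_perturb(1)[OF this]
  have "(\<Sum>k=1..D. a (- int k) * power_sum k (image_mset inverse S)) =
      (\<Sum>k=1..D. a (- int k) * power_sum k (image_mset inverse R))"
    using n neg by (intro sum.cong refl) auto
  moreover have "(\<Sum>k=1..D. a (int k) * power_sum k S) =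
      (\<Sum>k=1..D. a (int k) * power_sum k R - (if k = n then of_nat n * a (int n) else 0))"
  proof (intro sum.cong refl)
    fix k assume "k \<in> {1..D}"
    then show "a (int k) * power_sum k S = a (int k) * power_sum k R - (if k = n then of_nat n * a (int n) else 0)"
      using pos(1)[of k] pos(2) n(2)[of "int k"] by (cases k n rule: linorder_cases) (auto simp: right_diff_distrib mult.commute)
  qed
  ultimately show ?thesis
    using n R S by (simp add: divisor_eval_power_sums sum_subtractf)
qed

text \<open>
  Adding \<open>T ^ (m - n)\<close> to a polynomial of degree \<open>m\<close> permutes the index set of the sum and multiplies
  every term by one and the same nontrivial root of unity.
\<close>

lemma L_coeff_eq_0:
  fixes a :: "int \<Rightarrow> 'a::{alg_closed_field,field_prime_char}"
  assumes a: "\<And>k. a k \<in> subfld 1" and D: "D < CHAR('a)"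
    and n: "0 < n" "n \<le> D" "a (int n) \<noteq> 0" "\<And>k. k > int n \<Longrightarrow> a k = 0" and m: "n + D < m"
  shows "L_coeff a D m = 0"
proof -
  define \<psi> where "\<psi> g = add_char (divisor_eval a D (proots g))" for g :: "'a poly"
  have L: "L_coeff a D m = (\<Sum>g\<in>prime_polys m. \<psi> g)"
    unfolding L_coeff_def
    by (subst sum.reindex_bij_betw[OF bij_betw_root_poly, symmetric]) (simp add: \<psi>_def)
  define shift where "shift g = g + monom 1 (m - n)" for g :: "'a poly"
  define u where "u = - (of_nat n * a (int n))"
  have u: "u \<in> subfld 1" unfolding u_def by (intro subfld_uminus subfld_mult a) auto
  \<comment> \<open>Without \<open>D < CHAR('a)\<close> the shift could be invisible to the
    character.\<close>
  have "of_nat n \<noteq> (0 :: 'a)" using n D by (auto simp: of_nat_eq_0_iff_char_dvd dest: dvd_imp_le)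
  then have "u \<noteq> 0" using n by (simp add: u_def)
  have into: "shift g \<in> prime_polys m" if g: "g \<in> prime_polys m" for g
  proof -
    have "degree (monom (1 :: 'a) (m - n)) < degree g"
      using g m n by (simp add: degree_monom_eq prime_polys_def)
    then have "degree (shift g) = degree g" unfolding shift_def by (rule degree_add_eq_left)
    with g m n show ?thesis
      by (auto simp: prime_polys_def shift_def intro!: subfld_add)
  qed
  have "shift ` prime_polys m = prime_polys m"
    using into by (intro endo_inj_surj finite_prime_polys) (auto simp: inj_on_def shift_def)
  then have bij: "bij_betw shift (prime_polys m) (prime_polys m)"
    by (auto simp: bij_betw_def inj_on_def shift_def)
  have "L_coeff a D m = (\<Sum>g\<in>prime_polys m. \<psi> (shift g))"
    unfolding L by (rule sum.reindex_bij_betw[OF bij, symmetric])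
  also have "\<dots> = (\<Sum>g\<in>prime_polys m. \<psi> g * add_char u)"
  proof (intro sum.cong refl)
    fix g :: "'a poly" assume g: "g \<in> prime_polys m"
    have "prime_polys m = root_poly ` (divisors m :: 'a multiset set)"
      using bij_betw_root_poly by (auto simp: bij_betw_def)
    then obtain R S where R: "R \<in> divisors m" "g = root_poly R" and S: "S \<in> divisors m" "shift g = root_poly S"
      using g into[OF g] by blast
    have "divisor_eval a D S = divisor_eval a D R + u"
      using divisor_eval_perturb[of n a D m R S] R S n m by (simp add: divisors_def shift_def u_def)
    moreover have "divisor_eval a D R \<in> subfld 1" by (rule divisor_eval_in_prime[of a, OF a R(1)])
    ultimately show "\<psi> (shift g) = \<psi> g * add_char u"
      unfolding \<psi>_def S(2) using u by (simp add: R(2) add_char_add)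
  qed
  also have "\<dots> = L_coeff a D m * add_char u" by (simp add: L sum_distrib_right)
  finally have "L_coeff a D m * (1 - add_char u) = 0" by (simp add: algebra_simps)
  with add_char_neq_1[OF u \<open>u \<noteq> 0\<close>] show ?thesis by simp
qed

text \<open>
  A zero \<open>z\<close> of \<open>L\<close> inside the disc of convergence of \<open>G = \<Sum>S\<^sub>r T\<^sup>r\<close> is impossible, since \<open>T L' = L G\<close>
  and \<open>L'\<close> vanishes at \<open>z\<close> to a smaller order than \<open>L\<close>.
\<close>

lemma root_outside_convergence_disc:
  fixes L :: "complex poly" and G :: "complex fps"
  assumes L: "coeff L 0 \<noteq> 0" and ode: "fps_X * fps_deriv (fps_of_poly L) = fps_of_poly L * G"
    and root: "poly L z = 0"
  shows "ereal (norm z) \<ge> fps_conv_radius G"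
proof (rule ccontr)
  assume "\<not> ?thesis"
  then have z: "ereal (norm z) < fps_conv_radius G" by simp
  have "z \<noteq> 0" using L root by (auto simp: poly_0_coeff_0)
  have "L \<noteq> 0" using L by auto
  define k where "k = order z L"
  have k: "k > 0" using root \<open>L \<noteq> 0\<close> by (simp add: k_def order_gt_0_iff)
  have "pderiv L \<noteq> 0"
  proof
    assume "pderiv L = 0"
    then obtain c where "L = [:c:]" using pderiv_iszero by blast
    with root \<open>L \<noteq> 0\<close> show False by simp
  qed
  then have k': "order z (pderiv L) = k - 1"
    using order_pderiv[of L z] k root \<open>L \<noteq> 0\<close> by (simp add: k_def)
  obtain M where M: "L = [:- z, 1:] ^ k * M"
    using order_decomp[OF \<open>L \<noteq> 0\<close>, of z] by (auto simp: k_def)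
  obtain M' where M': "pderiv L = [:- z, 1:] ^ (k - 1) * M'" "\<not> [:- z, 1:] dvd M'"
    using order_decomp[OF \<open>pderiv L \<noteq> 0\<close>, of z] by (auto simp: k')
  have "poly M' z \<noteq> 0" using M'(2) by (simp add: poly_eq_0_iff_dvd)
  have eq: "t * poly (pderiv L) t = poly L t * eval_fps G t" if "ereal (norm t) < fps_conv_radius G" for t
  proof -
    have "eval_fps (fps_X * fps_of_poly (pderiv L)) t = eval_fps (fps_of_poly L * G) t"
      using ode by (simp add: fps_of_poly_pderiv)
    moreover have "fps_X * fps_of_poly (pderiv L) = fps_of_poly ([:0, 1:] * pderiv L)"
      by (simp add: fps_of_poly_mult fps_of_poly_pCons)
    ultimately show ?thesis using that
      by (simp add: eval_fps_mult)
  qed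
  obtain \<rho> where \<rho>: "norm z < \<rho>" "ereal \<rho> < fps_conv_radius G"
    using z ereal_dense2[OF z] by auto
  have "isCont (eval_fps G) z"
    using z by (intro continuous_eval_fps) auto
  then have cont: "(eval_fps G \<longlongrightarrow> eval_fps G z) (at z)" by (simp add: isCont_def)
  \<comment> \<open>After \<open>(t - z) ^ (k - 1)\<close> is cancelled from T L' = L G, a factor
    \<open>t - z\<close> remains on the right, while the left side tends to the nonzero value
    \<open>z * poly M' z\<close>.\<close>
  have "((\<lambda>t. (t - z) * poly M t * eval_fps G t) \<longlongrightarrow> (z - z) * poly M z * eval_fps G z) (at z)"
    by (intro tendsto_intros cont)
  then have lim0: "((\<lambda>t. (t - z) * poly M t * eval_fps G t) \<longlongrightarrow> 0) (at z)" by simp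
  have "\<forall>\<^sub>F t in at z. t \<in> ball 0 \<rho> - {z}"
    using \<rho>(1) eventually_at_in_open[of "ball 0 \<rho>" z] by simp
  then have "\<forall>\<^sub>F t in at z. (t - z) * poly M t * eval_fps G t = t * poly M' t"
  proof eventually_elim
    case (elim t)
    then have "norm t < \<rho>" "t \<noteq> z" by auto
    with \<rho>(2) have "ereal (norm t) < fps_conv_radius G" by (metis ereal_less_eq(3) le_less_trans less_imp_le)
    from eq[OF this] have "t * ((t - z) ^ (k - 1) * poly M' t) = (t - z) ^ k * poly M t * eval_fps G t"
      by (simp add: M(1)[THEN arg_cong[where f = "\<lambda>g. poly g t"]] M'(1) add.commute)
    also have "(t - z) ^ k = (t - z) ^ (k - 1) * (t - z)" using k by (simp flip: power_Suc2)
    finally have "(t - z) ^ (k - 1) * (t * poly M' t) = (t - z) ^ (k - 1) * ((t - z) * poly M t * eval_fps G t)"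
      by (simp add: mult_ac)
    then show ?case using \<open>t \<noteq> z\<close> by simp
  qed
  from Lim_transform_eventually[OF lim0 this] have "((\<lambda>t. t * poly M' t) \<longlongrightarrow> 0) (at z)" .
  moreover have "((\<lambda>t. t * poly M' t) \<longlongrightarrow> z * poly M' z) (at z)" by (intro tendsto_intros)
  ultimately have "z * poly M' z = 0" using tendsto_unique[OF trivial_limit_at] by blast
  with \<open>z \<noteq> 0\<close> \<open>poly M' z \<noteq> 0\<close> show False by simp
qed

text \<open>The bound for \<open>S 1\<close> involves neither \<open>C\<close> nor
  \<open>r0\<close>: a growth estimate for large \<open>r\<close> only places the zeros of the
  polynomial with coefficients \<open>c\<close> at distance at least \<open>1 / B\<close> from 0,
  and \<open>S 1\<close> is minus the sum of at most \<open>N\<close> inverses of zeros.\<close>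

lemma norm_le_of_newton_recurrence:
  fixes c S :: "nat \<Rightarrow> complex"
  assumes c0: "c 0 = 1" and cN: "\<And>m. m > N \<Longrightarrow> c m = 0"
    and rec: "\<And>m. of_nat m * c m = (\<Sum>r=1..m. c (m - r) * S r)"
    and S: "\<And>r. r \<ge> r0 \<Longrightarrow> cmod (S r) \<le> C * B ^ r" and B: "B > 0"
  shows "cmod (S 1) \<le> real N * B"
proof -
  define L where "L = (\<Sum>m\<le>N. monom (c m) m)"
  have coeff_L: "coeff L m = c m" for m
    using cN[of m] by (auto simp: L_def coeff_sum)
  \<comment> \<open>The recurrence starts at \<open>r = 1\<close>, so the constant term is set to
    0.\<close>
  define G where "G = Abs_fps (\<lambda>r. if r = 0 then 0 else S r)"
  have ode: "fps_X * fps_deriv (fps_of_poly L) = fps_of_poly L * G"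
  proof (rule fps_ext)
    fix m
    have "(fps_of_poly L * G) $ m = (\<Sum>r=0..m. G $ r * c (m - r))"
      by (subst mult.commute) (simp add: fps_mult_nth coeff_L)
    also have "\<dots> = (\<Sum>r=1..m. G $ r * c (m - r))"
      by (intro sum.mono_neutral_right) (auto simp: G_def)
    also have "\<dots> = of_nat m * c m"
      unfolding rec by (intro sum.cong) (auto simp: G_def)
    finally show "(fps_X * fps_deriv (fps_of_poly L)) $ m = (fps_of_poly L * G) $ m"
      by (cases m) (auto simp: coeff_L)
  qed
  have L0: "L \<noteq> 0" using coeff_L[of 0] c0 by auto
  have degL: "degree L \<le> N" using cN by (intro degree_le) (auto simp: coeff_L)
  have root: "norm z \<ge> 1 / B" if "poly L z = 0" for z
  proof (rule ccontr)
    assume "\<not> norm z \<ge> 1 / B"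
    then obtain \<rho> where \<rho>: "norm z < \<rho>" "\<rho> < 1 / B" using dense[of "norm z" "1 / B"] by auto
    then have "\<rho> > 0" using norm_ge_zero[of z] by linarith
    have "summable (\<lambda>r. G $ r * of_real \<rho> ^ r)"
    proof (rule summable_comparison_test)
      show "\<exists>N. \<forall>n\<ge>N. norm (G $ n * of_real \<rho> ^ n) \<le> C * (B * \<rho>) ^ n"
      proof (intro exI[of _ "max r0 1"] allI impI)
        fix n assume "n \<ge> max r0 1"
        then have "norm (G $ n) \<le> C * B ^ n" using S[of n] by (simp add: G_def)
        then have "norm (G $ n) * \<rho> ^ n \<le> C * B ^ n * \<rho> ^ n"
          using \<open>\<rho> > 0\<close> by (intro mult_right_mono) auto
        then show "norm (G $ n * of_real \<rho> ^ n) \<le> C * (B * \<rho>) ^ n"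
          using \<open>\<rho> > 0\<close> by (simp add: norm_mult norm_power power_mult_distrib mult.assoc)
      qed
      show "summable (\<lambda>n. C * (B * \<rho>) ^ n)"
        using \<rho> \<open>\<rho> > 0\<close> B by (intro summable_mult summable_geometric) (auto simp: field_simps)
    qed
    then have "conv_radius (fps_nth G) \<ge> norm (of_real \<rho> :: complex)" by (rule conv_radius_geI)
    then have "fps_conv_radius G \<ge> ereal \<rho>" using \<open>\<rho> > 0\<close> by (simp add: fps_conv_radius_def)
    moreover have "ereal (norm z) \<ge> fps_conv_radius G"
      by (rule root_outside_convergence_disc[OF _ ode that]) (simp add: coeff_L c0)
    ultimately have "ereal \<rho> \<le> ereal (norm z)" by (rule order_trans)
    with \<rho> show False by simp
  qed
  obtain R where R: "size R = degree L" "L = smult (lead_coeff L) (root_poly R)"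
    unfolding root_poly_def using alg_closed_imp_factorization[OF L0] by blast
  have "poly L z = 0" if "z \<in># R" for z
    using that by (subst R(2)) (simp add: root_poly_def poly_prod_mset prod_mset_zero_iff image_iff)
  then have roots: "norm z \<ge> 1 / B" if "z \<in># R" for z using root that by blast
  have R0: "0 \<notin># R" using roots[of 0] B by (auto simp: field_simps)
  have "fps_of_poly L = fps_const (coeff L 0) * root_fps (image_mset inverse R)"
  proof -
    have "fps_of_poly L = fps_const (lead_coeff L) * fps_of_poly (root_poly R)"
      by (subst R(2)) (simp add: fps_of_poly_smult)
    also have "\<dots> = fps_const (lead_coeff L * coeff (root_poly R) 0) * root_fps (image_mset inverse R)"
      unfolding fps_of_poly_root_poly[OF R0] by (simp add: mult.assoc flip: fps_const_mult)
    also have "lead_coeff L * coeff (root_poly R) 0 = coeff L 0"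
      using arg_cong[OF R(2), of "\<lambda>g. coeff g 0"] by simp
    finally show ?thesis .
  qed
  then have fps_L: "fps_of_poly L = root_fps (image_mset inverse R)" by (simp add: coeff_L c0)
  have "S 1 = c 1" using rec[of 1] c0 by simp
  also have "\<dots> = (fps_X * fps_deriv (fps_of_poly L)) $ 1" by (simp add: coeff_L)
  also have "\<dots> = - power_sum 1 (image_mset inverse R)"
    unfolding fps_L root_fps_log_deriv by (simp add: fps_mult_nth power_sum_fps_def)
  finally have "cmod (S 1) = cmod (\<Sum>z\<in>#R. inverse z)"
    by (simp add: power_sum_def image_mset.compositionality o_def)
  also have "\<dots> \<le> real (size R) * B"
    using roots
  proof (induction R)
    case (add z R)
    have "norm z \<ge> 1 / B" using add.prems by simp
    then have "cmod (inverse z) \<le> B"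
      using B le_imp_inverse_le[of "1 / B" "norm z"] by (simp add: norm_inverse)
    moreover have "cmod (\<Sum>z\<in>#R. inverse z) \<le> real (size R) * B" using add by simp
    ultimately have "cmod (inverse z) + cmod (\<Sum>z\<in>#R. inverse z) \<le> real (size (add_mset z R)) * B"
      by (simp add: algebra_simps)
    then show ?case using norm_triangle_ineq[of "inverse z" "\<Sum>z\<in>#R. inverse z"] by simp
  qed simp
  also have "\<dots> \<le> real N * B" using R(1) degL B by (intro mult_right_mono) auto
  finally show ?thesis .
qed

section \<open>Weil's bound for one-variable Laurent polynomials\<close>

text \<open>With \<open>n\<close> the largest positive exponent that occurs, L has degree at most
  \<open>n + D\<close>, hence at most \<open>2 * D\<close> zeros.\<close>

lemma weil_bound_pos:
  fixes a :: "int \<Rightarrow> 'a::{alg_closed_field,field_prime_char}"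
  assumes a: "\<And>k. a k \<in> subfld 1" and D: "D < CHAR('a)"
    and k: "0 < k" "k \<le> int D" "a k \<noteq> 0"
  shows "cmod (\<Sum>x\<in>subfld 1 - {0}. add_char (laurent_eval a D x)) \<le> 2 * real D * sqrt (real CHAR('a))"
proof -
  \<comment> \<open>\<open>laurent_eval\<close> ignores indices beyond \<open>D\<close>, but the
    results on L require coefficients that vanish above \<open>n\<close>.\<close>
  define a' where "a' k = (if \<bar>k\<bar> \<le> int D then a k else 0)" for k
  have a': "a' k \<in> subfld 1" for k unfolding a'_def using a by simp
  define N where "N = {n \<in> {1..D}. a (int n) \<noteq> 0}"
  define n where "n = Max N"
  have N: "finite N" "nat k \<in> N" using k by (auto simp: N_def)
  then have "n \<in> N" unfolding n_def by (intro Max_in) auto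
  then have n: "0 < n" "n \<le> D" "a' (int n) \<noteq> 0" by (auto simp: N_def a'_def)
  have top: "a' k = 0" if "k > int n" for k
  proof (rule ccontr)
    assume "a' k \<noteq> 0"
    then have "nat k \<in> N" using that n by (auto simp: a'_def N_def split: if_splits)
    then have "nat k \<le> n" unfolding n_def using N by (intro Max_ge) auto
    with that show False by simp
  qed
  obtain C r0 where C: "\<And>r. r \<ge> r0 \<Longrightarrow> cmod (exp_sum a' D r) \<le> C * sqrt (real CHAR('a)) ^ r"
    using norm_exp_sum_large_r[OF refl, of a' D n] a' D n top by blast
  have "cmod (exp_sum a' D 1) \<le> real (n + D) * sqrt (real CHAR('a))"
  proof (rule norm_le_of_newton_recurrence)
    show "of_nat m * L_coeff a' D m = (\<Sum>r=1..m. L_coeff a' D (m - r) * exp_sum a' D r)" for m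
      by (rule L_coeff_recurrence[of a', OF a'])
    show "L_coeff a' D m = 0" if "m > n + D" for m
      using L_coeff_eq_0[of a' D n m] a' D n top that by blast
    show "sqrt (real CHAR('a)) > 0" using CHAR_gt_1[where ?'a = 'a] by simp
  qed (use C in auto)
  also have "\<dots> \<le> 2 * real D * sqrt (real CHAR('a))" using n by (intro mult_right_mono) auto
  also have "exp_sum a' D 1 = (\<Sum>x\<in>subfld 1 - {0}. add_char (laurent_eval a D x))"
    by (auto simp: exp_sum_def trace_to_prime_def laurent_eval_def a'_def intro!: sum.cong arg_cong[of _ _ add_char])
  finally show ?thesis .
qed

text \<open>Inverting \<open>x\<close> exchanges positive and negative exponents, so any nonzero
  exponent suffices.\<close>

theorem weil_bound:
  fixes a :: "int \<Rightarrow> 'a::{alg_closed_field,field_prime_char}"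
  assumes a: "\<And>k. a k \<in> subfld 1" and D: "D < CHAR('a)"
    and k: "k \<noteq> 0" "\<bar>k\<bar> \<le> int D" "a k \<noteq> 0"
  shows "cmod (\<Sum>x\<in>subfld 1 - {0}. add_char (laurent_eval a D x)) \<le> 2 * real D * sqrt (real CHAR('a))"
proof (cases "k > 0")
  case True
  with weil_bound_pos[of a D k] assms show ?thesis by simp
next
  case False
  have "(\<Sum>x\<in>subfld 1 - {0}. add_char (laurent_eval a D x)) =
      (\<Sum>x\<in>subfld 1 - {0}. add_char (laurent_eval (\<lambda>k. a (- k)) D x))"
  proof (rule sum.reindex_bij_witness[of _ inverse inverse])
    fix x :: 'a assume "x \<in> subfld 1 - {0}"
    have "laurent_eval (\<lambda>k. a (- k)) D (inverse x) = laurent_eval a D x"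
      unfolding laurent_eval_def
      by (rule sum.reindex_bij_witness[of _ uminus uminus]) (auto simp: power_int_minus power_int_inverse)
    then show "add_char (laurent_eval (\<lambda>k. a (- k)) D (inverse x)) = add_char (laurent_eval a D x)" by simp
  qed (auto intro!: subfld_inverse)
  with weil_bound_pos[of "\<lambda>k. a (- k)" D "- k"] False assms show ?thesis by simp
qed

section \<open>Sums in several variables\<close>

text \<open>The terms are indexed by an arbitrary set \<open>E\<close>, so the coefficient of a
  power of one variable is obtained by merely shrinking \<open>E\<close>.\<close>

definition multi_eval :: "'e set \<Rightarrow> ('e \<Rightarrow> 'a) \<Rightarrow> ('e \<Rightarrow> nat \<Rightarrow> int) \<Rightarrow> nat set \<Rightarrow> (nat \<Rightarrow> 'a) \<Rightarrow> 'a::field" where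
  "multi_eval E c ex J y = (\<Sum>e\<in>E. c e * (\<Prod>j\<in>J. y j powi ex e j))"

lemma multi_eval_insert:
  assumes "finite E" "finite J" "j \<notin> J" "\<And>e. e \<in> E \<Longrightarrow> \<bar>ex e j\<bar> \<le> int D"
  shows "multi_eval E c ex (insert j J) (y(j := x)) =
    laurent_eval (\<lambda>k. multi_eval {e \<in> E. ex e j = k} c ex J y) D x"
proof -
  have prod: "(\<Prod>i\<in>insert j J. (y(j := x)) i powi ex e i) = x powi ex e j * (\<Prod>i\<in>J. y i powi ex e i)" for e
  proof -
    have "(\<Prod>i\<in>J. (y(j := x)) i powi ex e i) = (\<Prod>i\<in>J. y i powi ex e i)"
    proof (rule prod.cong)
      fix i assume "i \<in> J"
      then have "i \<noteq> j" using assms(3) by auto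
      then show "(y(j := x)) i powi ex e i = y i powi ex e i" by simp
    qed simp
    then show ?thesis using assms(2,3) by simp
  qed
  have "laurent_eval (\<lambda>k. multi_eval {e \<in> E. ex e j = k} c ex J y) D x =
      (\<Sum>k\<in>{- int D..int D}. \<Sum>e | e \<in> E \<and> ex e j = k. c e * (x powi ex e j * (\<Prod>i\<in>J. y i powi ex e i)))"
    unfolding laurent_eval_def multi_eval_def sum_distrib_right
    by (intro sum.cong refl) (auto simp: mult_ac)
  also have "\<dots> = (\<Sum>e\<in>E. c e * (x powi ex e j * (\<Prod>i\<in>J. y i powi ex e i)))"
    by (rule sum.group) (use assms in \<open>force simp: abs_le_iff\<close>)+
  finally show ?thesis by (simp only: multi_eval_def prod)
qed

text \<open>Multiplication by \<open>x ^ D\<close> yields a nonzero polynomial of degree at most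
  \<open>2 * D\<close>.\<close>

lemma card_laurent_roots:
  fixes a :: "int \<Rightarrow> 'a::field"
  assumes "a k \<noteq> 0" "\<bar>k\<bar> \<le> int D" "0 \<notin> V"
  shows "card {x \<in> V. laurent_eval a D x = 0} \<le> 2 * D"
proof -
  define F where "F = (\<Sum>k\<in>{- int D..int D}. monom (a k) (nat (k + int D)))"
  have "poly F x = x ^ D * laurent_eval a D x" if "x \<noteq> 0" for x
    unfolding F_def poly_sum poly_monom laurent_eval_def sum_distrib_left
  proof (intro sum.cong refl)
    fix k assume "k \<in> {- int D..int D}"
    then have "x ^ nat (k + int D) = x powi (k + int D)" by (simp add: power_int_def)
    also have "\<dots> = x powi k * x ^ D" using that by (simp add: power_int_add)
    finally show "a k * x ^ nat (k + int D) = x ^ D * (a k * x powi k)" by simp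
  qed
  then have "poly F x = 0" if "x \<in> V" "laurent_eval a D x = 0" for x
    using that assms(3) by (cases "x = 0") simp_all
  then have sub: "{x \<in> V. laurent_eval a D x = 0} \<subseteq> {x. poly F x = 0}" by blast
  have "coeff F (nat (k + int D)) = (\<Sum>k'\<in>{- int D..int D}. if k' = k then a k' else 0)"
    unfolding F_def coeff_sum using assms(2) by (intro sum.cong refl) auto
  also have "k \<in> {- int D..int D}" using assms(2) by auto
  then have "(\<Sum>k'\<in>{- int D..int D}. if k' = k then a k' else 0) = a k" by simp
  finally have "F \<noteq> 0" using assms(1) by auto
  have "degree F \<le> 2 * D"
    unfolding F_def
  proof (rule degree_sum_le)
    fix k assume "k \<in> {- int D..int D}"
    then have "nat (k + int D) \<le> 2 * D" by auto
    then show "degree (monom (a k) (nat (k + int D))) \<le> 2 * D" using degree_monom_le le_trans by blast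
  qed simp
  have "card {x \<in> V. laurent_eval a D x = 0} \<le> card {x. poly F x = 0}"
    using sub \<open>F \<noteq> 0\<close> by (intro card_mono poly_roots_finite)
  also have "\<dots> \<le> degree F" by (rule card_poly_roots_bound[OF \<open>F \<noteq> 0\<close>])
  finally show ?thesis using \<open>degree F \<le> 2 * D\<close> by simp
qed

lemma sum_PiE_insert:
  assumes "j \<notin> J"
  shows "(\<Sum>y\<in>insert j J \<rightarrow>\<^sub>E V. g y) = (\<Sum>y\<in>J \<rightarrow>\<^sub>E V. \<Sum>x\<in>V. g (y(j := x)))"
proof -
  have inj: "inj_on (\<lambda>(x, y). y(j := x)) (V \<times> (J \<rightarrow>\<^sub>E V))"
    by (rule inj_combinator[OF assms])
  have "(\<Sum>y\<in>insert j J \<rightarrow>\<^sub>E V. g y) = (\<Sum>(x, y)\<in>V \<times> (J \<rightarrow>\<^sub>E V). g (y(j := x)))"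
    unfolding PiE_insert_eq sum.reindex[OF inj] by (simp add: case_prod_unfold)
  also have "\<dots> = (\<Sum>x\<in>V. \<Sum>y\<in>J \<rightarrow>\<^sub>E V. g (y(j := x)))"
    by (rule sum.cartesian_product[symmetric])
  finally show ?thesis by (subst sum.swap) simp
qed

lemma card_filter_eq_sum: "finite A \<Longrightarrow> card {x \<in> A. P x} = (\<Sum>x\<in>A. if P x then 1 else 0)"
  by (simp add: sum.If_cases Int_def)

text \<open>A Schwartz-Zippel count. Some coefficient with respect to \<open>x\<^sub>j\<close> is a
  nonzero Laurent polynomial in the remaining variables: at its zeros, counted by induction, all of
  \<open>V\<close> is allowed for \<open>x\<^sub>j\<close>, elsewhere at most \<open>2 * D\<close>
  values. Injectivity of the exponents rules out cancellation between terms.\<close>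

lemma card_multi_eval_zeros:
  fixes c :: "'e \<Rightarrow> 'a::field"
  assumes "finite J" "finite V" "0 \<notin> V" "finite E" "E \<noteq> {}" "\<And>e. e \<in> E \<Longrightarrow> c e \<noteq> 0"
    "\<And>e j. e \<in> E \<Longrightarrow> j \<in> J \<Longrightarrow> \<bar>ex e j\<bar> \<le> int D" "inj_on (\<lambda>e. restrict (ex e) J) E"
  shows "card {y \<in> J \<rightarrow>\<^sub>E V. multi_eval E c ex J y = 0} * card V \<le> 2 * D * card J * card V ^ card J"
  using assms(1,4-)
proof (induction J arbitrary: E rule: finite_induct)
  case empty
  from empty.prems(2) obtain e where "e \<in> E" by blast
  \<comment> \<open>With no variables left, injectivity allows only one term, a nonzero
    constant.\<close>
  then have "E = {e}" "c e \<noteq> 0" using empty.prems(3,5) by (auto simp: inj_on_def)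
  then show ?case by (simp add: multi_eval_def)
next
  case (insert j J)
  obtain e0 where e0: "e0 \<in> E" using insert.prems(2) by blast
  define k where "k = ex e0 j"
  define Ek where "Ek = {e \<in> E. ex e j = k}"
  define A where "A y k' = multi_eval {e \<in> E. ex e j = k'} c ex J y" for y k'
  define Y where "Y = (J \<rightarrow>\<^sub>E V)"
  define Z where "Z = {y \<in> Y. A y k = 0}"
  have finY: "finite Y" unfolding Y_def using insert.hyps assms(2) by (intro finite_PiE) auto
  have cardY: "card Y = card V ^ card J" unfolding Y_def using insert.hyps by (simp add: card_funcsetE)
  have k: "\<bar>k\<bar> \<le> int D" using insert.prems(4)[OF e0, of j] by (simp add: k_def)
  have "inj_on (\<lambda>e. restrict (ex e) J) Ek"
  proof (rule inj_onI)
    fix e e' assume e: "e \<in> Ek" "e' \<in> Ek" and eq: "restrict (ex e) J = restrict (ex e') J"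
    have "restrict (ex e) (insert j J) i = restrict (ex e') (insert j J) i" for i
      using e fun_cong[OF eq, of i] by (auto simp: Ek_def restrict_def split: if_splits)
    then have "restrict (ex e) (insert j J) = restrict (ex e') (insert j J)" by blast
    then show "e = e'" by (rule inj_onD[OF insert.prems(5)]) (use e in \<open>auto simp: Ek_def\<close>)
  qed
  then have IH: "card Z * card V \<le> 2 * D * card J * card V ^ card J"
    unfolding Z_def A_def Y_def Ek_def[symmetric]
    by (rule insert.IH[rotated 4]) (use insert.prems(1,3,4) e0 in \<open>auto simp: Ek_def k_def\<close>)
  have eval: "multi_eval E c ex (insert j J) (y(j := x)) = laurent_eval (A y) D x" for y x
    unfolding A_def using insert.prems insert.hyps by (intro multi_eval_insert) auto
  have "card {y \<in> insert j J \<rightarrow>\<^sub>E V. multi_eval E c ex (insert j J) y = 0} =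
      (\<Sum>y\<in>insert j J \<rightarrow>\<^sub>E V. if multi_eval E c ex (insert j J) y = 0 then 1 else 0)"
    using insert.hyps assms(2) by (intro card_filter_eq_sum finite_PiE) auto
  also have "\<dots> = (\<Sum>y\<in>Y. \<Sum>x\<in>V. if laurent_eval (A y) D x = 0 then 1 else 0)"
    unfolding sum_PiE_insert[OF insert.hyps(2)] Y_def eval ..
  also have "\<dots> = (\<Sum>y\<in>Y. card {x \<in> V. laurent_eval (A y) D x = 0})"
    using assms(2) by (simp add: card_filter_eq_sum)
  also have "\<dots> \<le> (\<Sum>y\<in>Y. (if y \<in> Z then card V else 0) + 2 * D)"
  proof (rule sum_mono)
    fix y assume y: "y \<in> Y"
    have "card {x \<in> V. laurent_eval (A y) D x = 0} \<le> card V" using assms(2) by (intro card_mono) auto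
    moreover have "card {x \<in> V. laurent_eval (A y) D x = 0} \<le> 2 * D" if "y \<notin> Z"
      using that y k assms(3) by (intro card_laurent_roots[of "A y" k]) (auto simp: Z_def)
    ultimately show "card {x \<in> V. laurent_eval (A y) D x = 0} \<le> (if y \<in> Z then card V else 0) + 2 * D"
      by (cases "y \<in> Z") auto
  qed
  also have "\<dots> = card Z * card V + card Y * (2 * D)"
  proof -
    have "Y \<inter> Z = Z" by (auto simp: Z_def)
    then show ?thesis using finY by (simp add: sum.distrib sum.If_cases Int_def[symmetric])
  qed
  also have "\<dots> \<le> 2 * D * card J * card V ^ card J + card V ^ card J * (2 * D)"
    using IH cardY by simp
  also have "\<dots> = 2 * D * card (insert j J) * card V ^ card J"
    using insert.hyps by (simp add: algebra_simps)
  finally have "card {y \<in> insert j J \<rightarrow>\<^sub>E V. multi_eval E c ex (insert j J) y = 0} * card V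
      \<le> 2 * D * card (insert j J) * card V ^ card J * card V" by (rule mult_right_mono) simp
  then show ?case using insert.hyps by (simp add: mult_ac)
qed

text \<open>The exceptional choices contribute at most \<open>2 * D * card J * q ^ card J\<close> by
  the trivial bound, the other choices at most \<open>2 * D * sqrt q\<close> each by Weil's bound;
  this accounts for the factor \<open>card J + 1\<close>.\<close>

lemma multi_exp_sum_bound:
  fixes c :: "'e \<Rightarrow> 'a::{alg_closed_field,field_prime_char}"
  defines "V \<equiv> subfld 1 - {0 :: 'a}" and "q \<equiv> CHAR('a)"
  assumes J: "finite J" "i \<notin> J" and E: "finite E" "\<And>e. e \<in> E \<Longrightarrow> c e \<noteq> 0" "\<And>e. e \<in> E \<Longrightarrow> c e \<in> subfld 1"
    and ex: "\<And>e j. e \<in> E \<Longrightarrow> j \<in> insert i J \<Longrightarrow> \<bar>ex e j\<bar> \<le> int D" "inj_on (\<lambda>e. restrict (ex e) (insert i J)) E"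
    and e0: "e0 \<in> E" "ex e0 i \<noteq> 0" and D: "D < q"
  shows "cmod (\<Sum>y\<in>insert i J \<rightarrow>\<^sub>E V. add_char (multi_eval E c ex (insert i J) y))
    \<le> 2 * real D * real (card J + 1) * (real q ^ card J * sqrt (real q))"
proof -
  define k where "k = ex e0 i"
  define Ek where "Ek = {e \<in> E. ex e i = k}"
  define A where "A y k' = multi_eval {e \<in> E. ex e i = k'} c ex J y" for y k'
  define Y where "Y = (J \<rightarrow>\<^sub>E V)"
  define Z where "Z = {y \<in> Y. A y k = 0}"
  define W where "W y = cmod (\<Sum>x\<in>V. add_char (laurent_eval (A y) D x))" for y
  have q1: "q > 1" unfolding q_def by (rule CHAR_gt_1)
  have finV: "finite V" unfolding V_def by (simp add: finite_subfld)
  have cardV: "card V \<le> q"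
    unfolding V_def q_def using card_Diff1_le[of "subfld 1" "0 :: 'a"] by (simp add: card_subfld)
  have finY: "finite Y" unfolding Y_def using J finV by (intro finite_PiE) auto
  have cardY: "card Y \<le> q ^ card J"
    unfolding Y_def using J cardV by (simp add: card_funcsetE power_mono)
  have k: "\<bar>k\<bar> \<le> int D" "k \<noteq> 0" using ex(1)[OF e0(1), of i] e0(2) by (simp_all add: k_def)
  have "inj_on (\<lambda>e. restrict (ex e) J) Ek"
  proof (rule inj_onI)
    fix e e' assume e: "e \<in> Ek" "e' \<in> Ek" and eq: "restrict (ex e) J = restrict (ex e') J"
    have "restrict (ex e) (insert i J) j = restrict (ex e') (insert i J) j" for j
      using e fun_cong[OF eq, of j] by (auto simp: Ek_def restrict_def split: if_splits)
    then have "restrict (ex e) (insert i J) = restrict (ex e') (insert i J)" by blast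
    then show "e = e'" by (rule inj_onD[OF ex(2)]) (use e in \<open>auto simp: Ek_def\<close>)
  qed
  then have "card Z * card V \<le> 2 * D * card J * card V ^ card J"
    unfolding Z_def A_def Y_def Ek_def[symmetric]
    by (rule card_multi_eval_zeros[rotated 7]) (use J E(1,2) ex(1) e0 finV in \<open>auto simp: Ek_def k_def V_def\<close>)
  also have "\<dots> \<le> 2 * D * card J * q ^ card J" using cardV by (intro mult_left_mono power_mono) auto
  finally have "card Z * card V \<le> 2 * D * card J * q ^ card J" .
  then have cardZ: "real (card Z) * real (card V) \<le> 2 * real D * real (card J) * real q ^ card J"
    by (metis (mono_tags, lifting) of_nat_le_iff of_nat_mult of_nat_numeral of_nat_power)
  have A_prime: "A y k' \<in> subfld 1" if "y \<in> Y" for y k'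
    unfolding A_def multi_eval_def
  proof (intro subfld_sum subfld_mult)
    have "(\<Prod>j\<in>J. y j powi ex e j) \<in> subfld 1" for e
      using J(1) that
    proof -
      have "\<forall>j\<in>J. y j \<in> subfld 1" using that by (auto simp: Y_def V_def PiE_iff)
      with J(1) show ?thesis
        by (induction J rule: finite_induct) (auto intro!: subfld_mult subfld_powi)
    qed
    then show "(\<Prod>j\<in>J. y j powi ex e j) \<in> subfld 1" for e .
  qed (use E(3) in auto)
  have "(\<Sum>y\<in>insert i J \<rightarrow>\<^sub>E V. add_char (multi_eval E c ex (insert i J) y)) =
      (\<Sum>y\<in>Y. \<Sum>x\<in>V. add_char (laurent_eval (A y) D x))"
    unfolding sum_PiE_insert[OF J(2)] Y_def A_def
    using J E ex by (intro sum.cong refl arg_cong[of _ _ add_char] multi_eval_insert) auto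
  then have "cmod (\<Sum>y\<in>insert i J \<rightarrow>\<^sub>E V. add_char (multi_eval E c ex (insert i J) y)) \<le> (\<Sum>y\<in>Y. W y)"
    by (simp add: W_def norm_sum)
  also have "\<dots> \<le> (\<Sum>y\<in>Y. (if y \<in> Z then real (card V) else 0) + 2 * real D * sqrt (real q))"
  proof (rule sum_mono)
    fix y assume y: "y \<in> Y"
    have "W y \<le> (\<Sum>x\<in>V. cmod (add_char (laurent_eval (A y) D x)))" unfolding W_def by (rule norm_sum)
    then have "W y \<le> real (card V)" by simp
    moreover have "W y \<le> 2 * real D * sqrt (real q)" if "y \<notin> Z"
      unfolding W_def V_def q_def using that y k D A_prime[OF y]
      by (intro weil_bound[of "A y" D k]) (auto simp: Z_def q_def)
    ultimately show "W y \<le> (if y \<in> Z then real (card V) else 0) + 2 * real D * sqrt (real q)"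
      by (cases "y \<in> Z") (auto intro: add_increasing2)
  qed
  also have "\<dots> = real (card Z) * real (card V) + real (card Y) * (2 * real D * sqrt (real q))"
  proof -
    have "Y \<inter> Z = Z" by (auto simp: Z_def)
    then show ?thesis using finY by (simp add: sum.distrib sum.If_cases Int_def[symmetric])
  qed
  also have "\<dots> \<le> 2 * real D * real (card J) * real q ^ card J + real q ^ card J * (2 * real D * sqrt (real q))"
  proof (intro add_mono cardZ mult_right_mono)
    show "real (card Y) \<le> real q ^ card J" using cardY by (metis of_nat_le_iff of_nat_power)
  qed auto
  also have "\<dots> \<le> 2 * real D * real (card J) * (real q ^ card J * sqrt (real q)) + real q ^ card J * (2 * real D * sqrt (real q))"
  proof -
    have "real q ^ card J * 1 \<le> real q ^ card J * sqrt (real q)" using q1 by (intro mult_left_mono) auto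
    then show ?thesis by (intro add_right_mono mult_left_mono) auto
  qed
  also have "\<dots> = 2 * real D * real (card J + 1) * (real q ^ card J * sqrt (real q))"
    by (simp add: algebra_simps)
  finally show ?thesis .
qed

section \<open>Kloosterman sums as sums over the prime field\<close>

definition laurent_size :: "laurent_poly \<Rightarrow> nat" where
  "laurent_size f = (\<Sum>e\<in>Poly_Mapping.keys f. nat \<bar>Poly_Mapping.lookup f e\<bar> +
     (\<Sum>j\<in>Poly_Mapping.keys e. nat \<bar>Poly_Mapping.lookup e j\<bar>))"

definition K_bound :: "nat \<Rightarrow> laurent_poly \<Rightarrow> real" where
  "K_bound n f = 2 * real (laurent_size f) * real n"

text \<open>One number serves both purposes: it is the bound \<open>D\<close> for the exponents, and
  a prime above it divides none of the nonzero coefficients.\<close>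

lemma lookup_le_laurent_size:
  assumes "e \<in> Poly_Mapping.keys f"
  shows "\<bar>Poly_Mapping.lookup f e\<bar> \<le> int (laurent_size f)" "\<bar>Poly_Mapping.lookup e j\<bar> \<le> int (laurent_size f)"
proof -
  let ?s = "\<lambda>e. nat \<bar>Poly_Mapping.lookup f e\<bar> + (\<Sum>j\<in>Poly_Mapping.keys e. nat \<bar>Poly_Mapping.lookup e j\<bar>)"
  have "?s e \<le> laurent_size f"
    unfolding laurent_size_def using assms by (intro member_le_sum) auto
  moreover have "nat \<bar>Poly_Mapping.lookup e j\<bar> \<le> (\<Sum>j\<in>Poly_Mapping.keys e. nat \<bar>Poly_Mapping.lookup e j\<bar>)"
  proof (cases "j \<in> Poly_Mapping.keys e")
    case True
    then show ?thesis by (intro member_le_sum) auto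
  qed (simp add: in_keys_iff)
  ultimately show "\<bar>Poly_Mapping.lookup f e\<bar> \<le> int (laurent_size f)" "\<bar>Poly_Mapping.lookup e j\<bar> \<le> int (laurent_size f)"
    by linarith+
qed

lemma of_int_power_mod_inv:
  assumes "coprime x (int CHAR('a::field))"
  shows "of_int (power_mod_inv CHAR('a) x k) = (of_int x :: 'a) powi k"
proof -
  have "[x * modular_inverse (int CHAR('a)) x = 1] (mod int CHAR('a))"
    using assms by (intro cong_modular_inverse1) (simp add: coprime_commute)
  then have "of_int (x * modular_inverse (int CHAR('a)) x) = (of_int 1 :: 'a)"
    by (simp only: of_int_eq_iff_cong_CHAR)
  then have "of_int (modular_inverse (int CHAR('a)) x) = inverse (of_int x :: 'a)"
    by (metis inverse_unique of_int_1 of_int_mult)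
  then show ?thesis by (auto simp: power_mod_inv_def power_int_def)
qed

lemma of_int_eval_mod:
  assumes f: "f \<in> laurent_polys n" and x: "\<And>j. j \<in> {1..<n} \<Longrightarrow> coprime (x j) (int CHAR('a::field))"
  shows "of_int (eval_mod CHAR('a) f x) =
    multi_eval (Poly_Mapping.keys f) (\<lambda>e. of_int (Poly_Mapping.lookup f e)) Poly_Mapping.lookup {1..<n}
      (\<lambda>j. of_int (x j) :: 'a)"
proof -
  have "(\<Prod>j\<in>Poly_Mapping.keys e. of_int (power_mod_inv CHAR('a) (x j) (Poly_Mapping.lookup e j)) :: 'a) =
      (\<Prod>j\<in>{1..<n}. of_int (x j) powi Poly_Mapping.lookup e j)" if "e \<in> Poly_Mapping.keys f" for e
  proof (rule prod.mono_neutral_cong_left)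
    show sub: "Poly_Mapping.keys e \<subseteq> {1..<n}" using f that by (auto simp: laurent_polys_def)
    show "of_int (power_mod_inv CHAR('a) (x j) (Poly_Mapping.lookup e j)) = (of_int (x j) :: 'a) powi Poly_Mapping.lookup e j"
      if "j \<in> Poly_Mapping.keys e" for j
      using x sub that by (intro of_int_power_mod_inv) auto
  qed (auto simp: in_keys_iff)
  then show ?thesis by (simp add: eval_mod_def multi_eval_def of_int_sum of_int_prod)
qed

text \<open>Reduction modulo \<open>CHAR('a)\<close> maps the reduced residues bijectively onto the
  nonzero elements of the prime field and turns modular inverses into field inverses.\<close>

lemma K_eq_multi_exp_sum:
  assumes f: "f \<in> laurent_polys n"
  shows "K n f CHAR('a::{alg_closed_field,field_prime_char}) =
    (\<Sum>y\<in>{1..<n} \<rightarrow>\<^sub>E subfld 1 - {0 :: 'a}. add_char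
      (multi_eval (Poly_Mapping.keys f) (\<lambda>e. of_int (Poly_Mapping.lookup f e)) Poly_Mapping.lookup {1..<n} y))"
proof -
  define q where "q = CHAR('a)"
  define U where "U = {a. 1 \<le> a \<and> a < int q \<and> coprime a (int q)}"
  define V where "V = subfld 1 - {0 :: 'a}"
  have q: "prime q" unfolding q_def by (rule prime_CHAR_field)
  have bij: "bij_betw (of_int :: int \<Rightarrow> 'a) U V"
  proof (rule bij_betwI')
    fix x y assume "x \<in> U" "y \<in> U"
    then show "of_int x = (of_int y :: 'a) \<longleftrightarrow> x = y"
      by (auto simp: of_int_eq_iff_cong_CHAR q_def U_def cong_less_imp_eq_int)
  next
    fix x assume "x \<in> U"
    then have "\<not> int q dvd x" by (auto simp: U_def zdvd_not_zless)
    then show "of_int x \<in> V" by (simp add: V_def of_int_eq_0_iff_char_dvd q_def)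
  next
    fix y assume "y \<in> V"
    then obtain m where m: "y = of_nat m" "m < q" unfolding V_def prime_subfld_eq q_def by blast
    moreover have "m \<noteq> 0" using m \<open>y \<in> V\<close> by (intro notI) (simp add: V_def)
    ultimately have "\<not> q dvd m" by (auto dest: dvd_imp_le)
    then have "coprime m q" using q prime_imp_coprime coprime_commute by blast
    with m \<open>m \<noteq> 0\<close> have "int m \<in> U" "y = of_int (int m)" by (auto simp: U_def)
    then show "\<exists>x\<in>U. y = of_int x" by blast
  qed
  define g where "g = inv_into U (of_int :: int \<Rightarrow> 'a)"
  have g: "g (of_int x) = x" "of_int x \<in> V" if "x \<in> U" for x
    using that bij bij_betw_inv_into_left[OF bij that] by (auto simp: g_def bij_betw_def)
  have g': "of_int (g y) = y" "g y \<in> U" if "y \<in> V" for y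
    using that bij bij_betw_inv_into_right[OF bij that] bij_betw_inv_into[OF bij]
    by (auto simp: g_def bij_betw_def)
  let ?M = "multi_eval (Poly_Mapping.keys f) (\<lambda>e. of_int (Poly_Mapping.lookup f e) :: 'a) Poly_Mapping.lookup {1..<n}"
  have "K n f q = (\<Sum>p\<in>{1..<n} \<rightarrow>\<^sub>E U. add_char (?M (restrict (\<lambda>j. of_int (p j)) {1..<n})))"
    unfolding K_def U_def[symmetric]
  proof (intro sum.cong refl)
    fix p assume p: "p \<in> {1..<n} \<rightarrow>\<^sub>E U"
    have "exp (2 * of_real pi * \<i> / of_nat q * of_int (eval_mod q f p)) = cis (2 * pi * of_int (eval_mod q f p) / real q)"
      by (simp add: cis_conv_exp mult_ac)
    also have "\<dots> = add_char (of_int (eval_mod q f p) :: 'a)"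
      by (simp add: add_char_of_int q_def)
    also have "of_int (eval_mod q f p) = ?M (\<lambda>j. of_int (p j))"
      unfolding q_def using f p by (intro of_int_eval_mod) (auto simp: U_def q_def PiE_iff)
    also have "\<dots> = ?M (restrict (\<lambda>j. of_int (p j)) {1..<n})"
      by (auto simp: multi_eval_def intro!: sum.cong prod.cong)
    finally show "exp (2 * of_real pi * \<i> / of_nat q * of_int (eval_mod q f p)) =
        add_char (?M (restrict (\<lambda>j. of_int (p j)) {1..<n}))" .
  qed
  also have "\<dots> = (\<Sum>y\<in>{1..<n} \<rightarrow>\<^sub>E V. add_char (?M y))"
  proof (rule sum.reindex_bij_witness)
    fix p assume p: "p \<in> {1..<n} \<rightarrow>\<^sub>E U"
    then have U: "p j \<in> U" if "j \<in> {1..<n}" for j using that by (rule PiE_mem)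
    show "restrict (\<lambda>j. g (restrict (\<lambda>j. of_int (p j)) {1..<n} j)) {1..<n} = p"
      by (rule ext) (use U g PiE_arb[OF p] in \<open>simp add: restrict_def\<close>)
    show "restrict (\<lambda>j. of_int (p j)) {1..<n} \<in> {1..<n} \<rightarrow>\<^sub>E V"
      using U g(2) by (intro restrict_PiE_iff[THEN iffD2]) blast
    show "add_char (?M (restrict (\<lambda>j. of_int (p j)) {1..<n})) = add_char (?M (restrict (\<lambda>j. of_int (p j)) {1..<n}))" ..
  next
    fix y assume y: "y \<in> {1..<n} \<rightarrow>\<^sub>E V"
    then have V: "y j \<in> V" if "j \<in> {1..<n}" for j using that by (rule PiE_mem)
    show "restrict (\<lambda>j. of_int (restrict (\<lambda>j. g (y j)) {1..<n} j)) {1..<n} = y"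
      by (rule ext) (use V g' PiE_arb[OF y] in \<open>simp add: restrict_def\<close>)
    show "restrict (\<lambda>j. g (y j)) {1..<n} \<in> {1..<n} \<rightarrow>\<^sub>E U"
      using V g'(2) by (intro restrict_PiE_iff[THEN iffD2]) blast
  qed
  finally show ?thesis by (simp add: q_def V_def)
qed

text \<open>A nonconstant \<open>f\<close> has a nonzero exponent vector \<open>e0\<close>; any
  variable \<open>x\<^sub>i\<close> occurring in it can be the one summed by Weil's bound. The other
  \<open>n - 2\<close> variables and the square root give the exponent
  \<open>(n - 2) + 1 / 2\<close>.\<close>

lemma K_bound_char:
  assumes q: "q = CHAR('a::{alg_closed_field,field_prime_char})" "q > laurent_size f"
    and f: "f \<in> laurent_polys n" "\<not> (\<exists>c. f = Poly_Mapping.single 0 c)"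
  shows "cmod (K n f q) \<le> K_bound n f * real q powr ((real n - 1) - 1 / 2)"
proof -
  let ?E = "Poly_Mapping.keys f"
  have "\<exists>e\<in>?E. e \<noteq> 0"
  proof (rule ccontr)
    assume "\<not> ?thesis"
    then have "f = Poly_Mapping.single 0 (Poly_Mapping.lookup f 0)"
      by (intro poly_mapping_eqI) (auto simp: lookup_single when_def in_keys_iff)
    with f(2) show False by blast
  qed
  then obtain e0 where e0: "e0 \<in> ?E" "e0 \<noteq> 0" by blast
  then have "Poly_Mapping.keys e0 \<noteq> {}" by (simp add: keys_eq_empty)
  then obtain i where i: "i \<in> Poly_Mapping.keys e0" by blast
  with f(1) e0(1) have "i \<in> {1..<n}" unfolding laurent_polys_def by blast
  define J where "J = {1..<n} - {i}"
  have J: "finite J" "i \<notin> J" "insert i J = {1..<n}" using \<open>i \<in> {1..<n}\<close> by (auto simp: J_def)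
  have cardJ: "card J = n - 2" "n \<ge> 2" using \<open>i \<in> {1..<n}\<close> by (auto simp: J_def)
  have q1: "q > 1" unfolding q(1) by (rule CHAR_gt_1)
  have "cmod (K n f q) \<le> 2 * real (laurent_size f) * real (card J + 1) * (real q ^ card J * sqrt (real q))"
    unfolding q(1) K_eq_multi_exp_sum[OF f(1)] J(3)[symmetric]
  proof (rule multi_exp_sum_bound[where ?e0.0 = e0])
    fix e assume e: "e \<in> ?E"
    then have nz: "Poly_Mapping.lookup f e \<noteq> 0" by (simp add: in_keys_iff)
    have "\<bar>Poly_Mapping.lookup f e\<bar> < \<bar>int q\<bar>" using lookup_le_laurent_size(1)[OF e] q(2) by linarith
    with dvd_imp_le_int[OF nz, of "int q"] have "\<not> int q dvd Poly_Mapping.lookup f e" by linarith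
    then show "of_int (Poly_Mapping.lookup f e) \<noteq> (0 :: 'a)" by (simp add: of_int_eq_0_iff_char_dvd q(1))
    show "\<bar>Poly_Mapping.lookup e j\<bar> \<le> int (laurent_size f)" for j by (rule lookup_le_laurent_size(2)[OF e])
  next
    show "inj_on (\<lambda>e. restrict (Poly_Mapping.lookup e) (insert i J)) ?E"
    proof (rule inj_onI)
      fix e e' assume e: "e \<in> ?E" "e' \<in> ?E"
        and eq: "restrict (Poly_Mapping.lookup e) (insert i J) = restrict (Poly_Mapping.lookup e') (insert i J)"
      show "e = e'"
      proof (rule poly_mapping_eqI)
        fix j
        show "Poly_Mapping.lookup e j = Poly_Mapping.lookup e' j"
        proof (cases "j \<in> {1..<n}")
          case True
          then show ?thesis using fun_cong[OF eq, of j] by (simp add: J(3))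
        next
          case False
          then have "j \<notin> Poly_Mapping.keys e" "j \<notin> Poly_Mapping.keys e'"
            using f(1) e unfolding laurent_polys_def by blast+
          then show ?thesis by (simp add: in_keys_iff)
        qed
      qed
    qed
  qed (use J e0 i q in \<open>auto simp: in_keys_iff\<close>)
  also have "real q ^ card J * sqrt (real q) = real q powr ((real n - 1) - 1 / 2)"
  proof -
    have "real q ^ card J * sqrt (real q) = real q powr real (n - 2) * real q powr (1 / 2)"
      using q1 by (simp add: cardJ powr_realpow powr_half_sqrt del: of_nat_diff)
    also have "\<dots> = real q powr (real (n - 2) + 1 / 2)" by (simp add: powr_add)
    also have "real (n - 2) + 1 / 2 = (real n - 1) - 1 / 2" using cardJ by simp
    finally show ?thesis .
  qed
  also have "2 * real (laurent_size f) * real (card J + 1) * real q powr ((real n - 1) - 1 / 2)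
      \<le> K_bound n f * real q powr ((real n - 1) - 1 / 2)"
    unfolding K_bound_def using cardJ by (intro mult_right_mono mult_left_mono) auto
  finally show ?thesis .
qed

text \<open>Intended for the primes up to \<open>laurent_size f\<close>, where
  \<open>sqrt (real q)\<close> is bounded in terms of \<open>f\<close>.\<close>

lemma K_trivial_bound:
  assumes "n \<ge> 2" "q > 0"
  shows "cmod (K n f q) \<le> sqrt (real q) * real q powr ((real n - 1) - 1 / 2)"
proof -
  define U where "U = {a. 1 \<le> a \<and> a < int q \<and> coprime a (int q)}"
  have "U \<subseteq> {1..<int q}" by (auto simp: U_def)
  then have U: "finite U" "card U \<le> q"
    using card_mono[of "{1..<int q}" U] finite_subset[of U "{1..<int q}"] by auto
  have "cmod (K n f q) \<le> (\<Sum>p\<in>{1..<n} \<rightarrow>\<^sub>E U. cmod (exp (2 * of_real pi * \<i> / of_nat q * of_int (eval_mod q f p))))"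
    unfolding K_def U_def by (rule norm_sum)
  also have "\<dots> = (\<Sum>p\<in>{1..<n} \<rightarrow>\<^sub>E U. 1)" by (intro sum.cong refl) simp
  also have "\<dots> = real (card U ^ (n - 1))" by (simp add: card_funcsetE)
  also have "\<dots> \<le> real (q ^ (n - 1))" unfolding of_nat_le_iff using U by (intro power_mono) auto
  also have "\<dots> = real q powr (1 / 2 + ((real n - 1) - 1 / 2))"
    using assms by (simp add: powr_realpow[symmetric] of_nat_diff)
  also have "\<dots> = sqrt (real q) * real q powr ((real n - 1) - 1 / 2)"
    using assms by (simp only: powr_add powr_half_sqrt of_nat_0_le_iff)
  finally show ?thesis .
qed

text \<open>
  The preceding bound needs a field type of characteristic \<open>q\<close>, and HOL has no types depending on a
  number. But a prime violating the bound, if there is one, can be chosen once and for all as a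
  constant; a type can be defined from it, and applying the bound to that type is a contradiction.
\<close>

definition K_bounded_at :: "nat \<Rightarrow> bool" where
  "K_bounded_at q \<longleftrightarrow> (\<forall>n f. f \<in> laurent_polys n \<longrightarrow> \<not> (\<exists>c. f = Poly_Mapping.single 0 c) \<longrightarrow> laurent_size f < q \<longrightarrow>
     cmod (K n f q) \<le> K_bound n f * real q powr ((real n - 1) - 1 / 2))"

text \<open>The default 2 makes this a prime in either case, so the type below can be defined
  unconditionally.\<close>

definition suspect_prime :: nat where
  "suspect_prime = (if \<exists>q. prime q \<and> \<not> K_bounded_at q then SOME q. prime q \<and> \<not> K_bounded_at q else 2)"

lemma prime_suspect_prime: "prime suspect_prime"
proof (cases "\<exists>q::nat. prime q \<and> \<not> K_bounded_at q")
  case True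
  from someI_ex[OF True] show ?thesis unfolding suspect_prime_def if_P[OF True] by blast
next
  case False
  show ?thesis unfolding suspect_prime_def if_not_P[OF False] by (rule two_is_prime_nat)
qed

text \<open>The prime cardinality makes \<open>suspect_index mod_ring\<close> a prime field; its
  algebraic closure is the type to which the bound is applied.\<close>

typedef suspect_index = "{..<suspect_prime}"
  using prime_gt_0_nat[OF prime_suspect_prime] by blast

lemma CARD_suspect_index: "CARD(suspect_index) = suspect_prime"
  using type_definition.card[OF type_definition_suspect_index] by simp

instance suspect_index :: finite
proof
  show "finite (UNIV :: suspect_index set)"
    using CARD_suspect_index prime_gt_0_nat[OF prime_suspect_prime] by (intro card_ge_0_finite) simp
qed

instance suspect_index :: prime_card
  by standard (simp add: CARD_suspect_index prime_suspect_prime)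

instance alg_closure :: (field_prime_char) field_prime_char
  by (rule field_prime_charI'[where ?'a = "'a alg_closure"]) simp

lemma K_bounded_at_prime:
  assumes "prime q" shows "K_bounded_at q"
proof (rule ccontr)
  assume "\<not> K_bounded_at q"
  with assms have ex: "\<exists>q. prime q \<and> \<not> K_bounded_at q" by blast
  have "\<not> K_bounded_at suspect_prime"
    using someI_ex[OF ex] unfolding suspect_prime_def if_P[OF ex] by blast
  moreover have "suspect_prime = CHAR(suspect_index mod_ring alg_closure)"
    by (simp add: CARD_suspect_index)
  then have "K_bounded_at suspect_prime"
    unfolding K_bounded_at_def using K_bound_char[where ?'a = "suspect_index mod_ring alg_closure"] by blast
  ultimately show False by blast
qed

text \<open>A nonzero constant \<open>f\<close> satisfies \<open>condition_H\<close> for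
  \<open>n \<ge> 2\<close>, yet its sum has absolute value \<open>(q - 1) ^ (n - 1)\<close>, which
  exceeds any bound of the claimed order. This is the reason for \<open>nonconstant\<close>.\<close>

theorem proposition6p4:
  fixes n :: nat and f :: laurent_poly
  assumes "f \<in> laurent_polys n"
    and "condition_H n f"
    and nonconstant: "\<not> (\<exists>c. f = Poly_Mapping.single 0 c)"
  shows "(\<exists>C\<^sub>1::real. finite {q. prime q \<and>
            \<not> (cmod (K n f q) \<le> C\<^sub>1 * real q powr ((real n - 1) - 1 / 2))})
       \<and> (\<exists>C\<^sub>1::real. \<forall>q. prime q \<longrightarrow>
            cmod (K n f q) \<le> C\<^sub>1 * real q powr ((real n - 1) - 1 / 2))"
proof -
  \<comment> \<open>The second entry covers the primes \<open>q \<le> laurent_size f\<close> through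
    the trivial bound.\<close>
  define C where "C = max (K_bound n f) (sqrt (real (laurent_size f)))"
  have "n \<ge> 2" using assms(2) by (auto simp: condition_H_def)
  have bound: "cmod (K n f q) \<le> C * real q powr ((real n - 1) - 1 / 2)" if q: "prime q" for q
  proof (cases "laurent_size f < q")
    case True
    with K_bounded_at_prime[OF q] assms
    have "cmod (K n f q) \<le> K_bound n f * real q powr ((real n - 1) - 1 / 2)"
      unfolding K_bounded_at_def by blast
    also have "\<dots> \<le> C * real q powr ((real n - 1) - 1 / 2)" by (intro mult_right_mono) (auto simp: C_def)
    finally show ?thesis .
  next
    case False
    have "cmod (K n f q) \<le> sqrt (real q) * real q powr ((real n - 1) - 1 / 2)"
      using K_trivial_bound[OF \<open>n \<ge> 2\<close>] prime_gt_0_nat[OF q] by blast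
    also have "\<dots> \<le> C * real q powr ((real n - 1) - 1 / 2)"
      using False by (intro mult_right_mono) (auto simp: C_def le_max_iff_disj)
    finally show ?thesis .
  qed
  then have "{q. prime q \<and> \<not> (cmod (K n f q) \<le> C * real q powr ((real n - 1) - 1 / 2))} = {}" by blast
  with bound show ?thesis by (metis (no_types, lifting) finite.emptyI)
qed

end
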